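(* Let $(V,E)$ and $(W,F)$ be lattice-normed spaces with $V$ decomposable, $W$ a Banach-Kantorovich space and $F$ Dedekind complete. Then the space $\mathcal{D}_U(V,W)$ of all dominated Uryson operators from $V$ to $W$, equipped with the $\mathcal{U}^{ev}(E,F)$-valued norm assigning to $T$ its exact dominant $\|T\|$, is a Banach-Kantorovich space.
   Context: Lattice-normed spaces. Let $V$ be a real vector space and $E$ a real Archimedean vector lattice. A vector norm is a map $\|\cdot\|:V\to E$ with $\|v\|\ge 0$, $\|v\|=0\Leftrightarrow v=0$, $\|v_1+v_2\|\le\|v_1\|+\|v_2\|$, $\|\lambda v\|=|\lambda|\,\|v\|$ ($\lambda\in\mathbb{R}$). $(V,E)$ is then a lattice-normed space. It is decomposable if whenever $\|x\|=e_1+e_2$ with $e_1,e_2\in E_+$ there are $x_1,x_2\in V$ with $x=x_1+x_2$ and $\|x_k\|=e_k$ ($k=1,2$). Elements $x,y\in V$ are disjoint, $x\perp y$, if $\|x\|\wedge\|y\|=0$. A net $(v_\alpha)$ in $V$ $(bo)$-converges to $v\in V$ if there is a decreasing net $(e_\gamma)_{\gamma\in\Gamma}$ in $E$ with $\inf_\gamma e_\gamma=0$ such that for every $\gamma$ there is an index $\alpha(\gamma)$ with $\|v-v_\alpha\|\le e_\gamma$ for all $\alpha\ge\alpha(\gamma)$. A net $(v_\alpha)$ is $(bo)$-fundamental if the net $(v_\alpha-v_\beta)_{(\alpha,\beta)}$ $(bo)$-converges to $0$. $V$ is $(bo)$-complete if every $(bo)$-fundamental net $(bo)$-converges to an element of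 $V$. A Banach-Kantorovich space is a decomposable $(bo)$-complete lattice-normed space. Abstract Uryson operators. In a vector lattice, $x\perp y$ means $|x|\wedge|y|=0$. A map $S:E\to F$ between vector lattices is orthogonally additive if $S(x+y)=Sx+Sy$ whenever $x\perp y$; positive if $Sx\ge0$ for all $x\in E$; order bounded if it maps order bounded sets to order bounded sets; even if $S(x)=S(-x)$ for all $x$. An abstract Uryson operator is an orthogonally additive order bounded map. $\mathcal{U}^{ev}(E,F)$ is the space of even abstract Uryson operators, ordered by $S_1\le S_2$ iff $S_2-S_1$ is positive; it is a Dedekind complete vector lattice when $F$ is Dedekind complete. $\mathcal{U}_+^{ev}(E,F)$ is its positive cone. Dominated Uryson operators. A map $T:V\to W$ is orthogonally additive if $T(u+v)=Tu+Tv$ whenever $u\perp v$ in $V$. It is a dominated Uryson operator if it is orthogonally additive and there is $S\in\mathcal{U}_+^{ev}(E,F)$ with $\|Tv\|\le S\|v\|$ for all $v\in V$; such an $S$ is a dominant of $T$. The exact dominant $\|T\|\in\mathcal{U}_+^{ev}(E,F)$ is the least dominant of $T$; it exists when $V$ is decomposable and $F$ is Dedekind complete. *)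

theory Defs
  imports Complex_Main
    "HOL-Library.Function_Algebras"
    "HOL-Library.Lattice_Algebras"
    "HOL-Library.Lub_Glb"
begin

text \<open>Functions form an ordered real vector space under the pointwise operations and the
  pointwise order; spaces of operators are treated as subspaces of it. For
  \<open>S\<^sub>1\<close>, \<open>S\<^sub>2\<close> the pointwise order \<open>S\<^sub>1 \<le> S\<^sub>2\<close> says that \<open>S\<^sub>2 - S\<^sub>1\<close> is positive. The lattice
  operations of such a subspace need not be pointwise, which is why suprema and infima
  are taken relative to a carrier set below (\<open>isLub\<close>, \<open>isGlb\<close>).\<close>

instantiation "fun" :: (type, real_vector) real_vector
begin

definition scaleR_fun :: "real \<Rightarrow> ('a \<Rightarrow> 'b) \<Rightarrow> 'a \<Rightarrow> 'b"
  where "scaleR_fun c f = (\<lambda>x. c *\<^sub>R f x)"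

instance
  by standard (auto simp: scaleR_fun_def fun_eq_iff scaleR_add_right scaleR_add_left)

end

instance "fun" :: (type, ordered_real_vector) ordered_real_vector
  by standard
    (auto simp: scaleR_fun_def le_fun_def intro: scaleR_left_mono scaleR_right_mono)


section \<open>Lattice-normed spaces\<close>

definition archimedean_vector_lattice :: "'e::ordered_real_vector set \<Rightarrow> bool"
  where "archimedean_vector_lattice E \<longleftrightarrow>
    subspace E \<and>
    (\<forall>x\<in>E. \<forall>y\<in>E. (\<exists>s. isLub E {x, y} s) \<and> (\<exists>i. isGlb E {x, y} i)) \<and>
    (\<forall>x\<in>E. \<forall>y\<in>E. (\<forall>n::nat. real n *\<^sub>R x \<le> y) \<longrightarrow> x \<le> 0)"

definition lattice_normed_space ::
  "'v::real_vector set \<Rightarrow> 'e::ordered_real_vector set \<Rightarrow> ('v \<Rightarrow> 'e) \<Rightarrow> bool"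
  where "lattice_normed_space V E nrm \<longleftrightarrow>
    subspace V \<and> archimedean_vector_lattice E \<and>
    (\<forall>v\<in>V. nrm v \<in> E \<and> 0 \<le> nrm v \<and> (nrm v = 0 \<longleftrightarrow> v = 0)) \<and>
    (\<forall>v\<in>V. \<forall>w\<in>V. nrm (v + w) \<le> nrm v + nrm w) \<and>
    (\<forall>c. \<forall>v\<in>V. nrm (c *\<^sub>R v) = \<bar>c\<bar> *\<^sub>R nrm v)"

definition decomposable ::
  "'v::real_vector set \<Rightarrow> 'e::ordered_real_vector set \<Rightarrow> ('v \<Rightarrow> 'e) \<Rightarrow> bool"
  where "decomposable V E nrm \<longleftrightarrow>
    (\<forall>x\<in>V. \<forall>e\<^sub>1\<in>E. \<forall>e\<^sub>2\<in>E. 0 \<le> e\<^sub>1 \<and> 0 \<le> e\<^sub>2 \<and> nrm x = e\<^sub>1 + e\<^sub>2 \<longrightarrow>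
      (\<exists>x\<^sub>1\<in>V. \<exists>x\<^sub>2\<in>V. x = x\<^sub>1 + x\<^sub>2 \<and> nrm x\<^sub>1 = e\<^sub>1 \<and> nrm x\<^sub>2 = e\<^sub>2))"


section \<open>Nets and (bo)-convergence\<close>

text \<open>A net is a family indexed by \<open>Field r\<close>, where \<open>(a, b) \<in> r\<close> means \<open>a \<le> b\<close>.\<close>

definition directed :: "'i rel \<Rightarrow> bool"
  where "directed r \<longleftrightarrow> Preorder r \<and> Field r \<noteq> {} \<and>
    (\<forall>a\<in>Field r. \<forall>b\<in>Field r. \<exists>c. (a, c) \<in> r \<and> (b, c) \<in> r)"

definition prod_rel :: "'i rel \<Rightarrow> 'j rel \<Rightarrow> ('i \<times> 'j) rel"
  where "prod_rel r s = {((a, b), (c, d)). (a, c) \<in> r \<and> (b, d) \<in> s}"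

definition regulates ::
  "'e::ordered_real_vector set \<Rightarrow> ('v::real_vector \<Rightarrow> 'e) \<Rightarrow> 'i rel \<Rightarrow> ('i \<Rightarrow> 'v) \<Rightarrow> 'v \<Rightarrow>
    'g rel \<Rightarrow> ('g \<Rightarrow> 'e) \<Rightarrow> bool"
  where "regulates E nrm r x v q e \<longleftrightarrow>
    directed q \<and> e ` Field q \<subseteq> E \<and> (\<forall>(\<gamma>, \<delta>)\<in>q. e \<delta> \<le> e \<gamma>) \<and> isGlb E (e ` Field q) 0 \<and>
    (\<forall>\<gamma>\<in>Field q. \<exists>a\<in>Field r. \<forall>b. (a, b) \<in> r \<longrightarrow> nrm (v - x b) \<le> e \<gamma>)"

text \<open>The index set of the decreasing net is taken inside the type of \<open>E\<close>; by
  \<open>bo_convergesI\<close> below this admits decreasing nets over every index type.\<close>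

definition bo_converges ::
  "'e::ordered_real_vector set \<Rightarrow> ('v::real_vector \<Rightarrow> 'e) \<Rightarrow> 'i rel \<Rightarrow> ('i \<Rightarrow> 'v) \<Rightarrow> 'v \<Rightarrow> bool"
  where "bo_converges E nrm r x v \<longleftrightarrow>
    (\<exists>(q :: 'e rel) e. regulates E nrm r x v q e)"

definition bo_fundamental ::
  "'e::ordered_real_vector set \<Rightarrow> ('v::real_vector \<Rightarrow> 'e) \<Rightarrow> 'i rel \<Rightarrow> ('i \<Rightarrow> 'v) \<Rightarrow> bool"
  where "bo_fundamental E nrm r x \<longleftrightarrow>
    bo_converges E nrm (prod_rel r r) (\<lambda>(a, b). x a - x b) 0"

text \<open>A formula cannot quantify over the type of the indices of a net, so completeness
  carries it as a parameter. By \<open>bo_complete_all_types\<close> below, completeness for the index type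
  \<open>'v \<times> 'v set\<close> implies completeness for every index type.\<close>

definition bo_complete :: "'i itself \<Rightarrow>
    'v::real_vector set \<Rightarrow> 'e::ordered_real_vector set \<Rightarrow> ('v \<Rightarrow> 'e) \<Rightarrow> bool"
  where "bo_complete (I :: 'i itself) V E nrm \<longleftrightarrow>
    (\<forall>(r :: 'i rel) x. directed r \<and> x ` Field r \<subseteq> V \<and> bo_fundamental E nrm r x \<longrightarrow>
      (\<exists>v\<in>V. bo_converges E nrm r x v))"

definition banach_kantorovich :: "'i itself \<Rightarrow>
    'v::real_vector set \<Rightarrow> 'e::ordered_real_vector set \<Rightarrow> ('v \<Rightarrow> 'e) \<Rightarrow> bool"
  where "banach_kantorovich I V E nrm \<longleftrightarrow>
    lattice_normed_space V E nrm \<and> decomposable V E nrm \<and> bo_complete I V E nrm"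

lemma bo_convergesI:
  fixes q :: "'g rel"
  assumes "regulates E nrm r x v q e"
  shows "bo_converges E nrm r x v"
proof -
  define D where "D = e ` Field q"
  define p where "p = {(a, b). a \<in> D \<and> b \<in> D \<and> b \<le> a}"
  have F: "Field p = D"
    by (auto simp: p_def Field_def)
  have "directed p"
    unfolding directed_def F
  proof (intro conjI ballI)
    show "preorder_on D p"
      by (auto simp: preorder_on_def refl_on_def trans_def p_def)
    show "D \<noteq> {}"
      using assms by (auto simp: D_def regulates_def directed_def)
    fix a b assume "a \<in> D" "b \<in> D"
    then obtain i j where ij: "i \<in> Field q" "j \<in> Field q" "a = e i" "b = e j"
      by (auto simp: D_def)
    then obtain k where k: "(i, k) \<in> q" "(j, k) \<in> q"
      using assms unfolding regulates_def directed_def by blast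
    then have "e k \<le> a" "e k \<le> b" "e k \<in> D"
      using assms ij by (auto simp: regulates_def D_def Field_def)
    with \<open>a \<in> D\<close> \<open>b \<in> D\<close> show "\<exists>c. (a, c) \<in> p \<and> (b, c) \<in> p"
      by (auto simp: p_def)
  qed
  then have "regulates E nrm r x v p (\<lambda>d. d)"
    using assms unfolding regulates_def F by (auto simp: D_def p_def)
  then show ?thesis
    unfolding bo_converges_def by blast
qed

lemma bo_complete_all_types:
  fixes V :: "'v::real_vector set" and E :: "'e::ordered_real_vector set"
  assumes "bo_complete TYPE('v \<times> 'v set) V E nrm"
  shows "bo_complete TYPE('i) V E nrm"
  unfolding bo_complete_def
proof (intro allI impI, elim conjE)
  fix r :: "'i rel" and x
  assume r: "directed r" and xV: "x ` Field r \<subseteq> V" and fund: "bo_fundamental E nrm r x"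
  define \<phi> where "\<phi> a = (x a, x ` (r `` {a}))" for a
  define J where "J = \<phi> ` Field r"
  define s where "s = {(p, q). p \<in> J \<and> q \<in> J \<and> snd q \<subseteq> snd p}"
  have F: "Field s = J"
    unfolding Field_def Domain_iff Range_iff s_def by blast
  have refl: "(a, a) \<in> r" if "a \<in> Field r" for a
    using r that by (auto simp: directed_def preorder_on_def refl_on_def)
  have trans: "(a, c) \<in> r" if "(a, b) \<in> r" "(b, c) \<in> r" for a b c
    using r that by (auto simp: directed_def preorder_on_def dest: transD)
  have up: "(\<phi> a, \<phi> b) \<in> s" if "(a, b) \<in> r" for a b
    using that trans by (auto simp: s_def J_def \<phi>_def Field_def)
  have down: "\<exists>c. (a, c) \<in> r \<and> fst q = x c" if q: "(\<phi> a, q) \<in> s" for a q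
  proof -
    obtain b where b: "b \<in> Field r" "q = \<phi> b" "snd q \<subseteq> snd (\<phi> a)"
      using q unfolding s_def J_def by blast
    then have "x b \<in> snd q"
      using refl by (auto simp: \<phi>_def)
    with b show ?thesis
      by (auto simp: \<phi>_def)
  qed
  have "directed s"
    unfolding directed_def F
  proof (intro conjI ballI)
    show "preorder_on J s"
      by (auto simp: preorder_on_def refl_on_def trans_def s_def)
    show "J \<noteq> {}"
      using r by (auto simp: J_def directed_def)
    fix a b assume "a \<in> J" "b \<in> J"
    then obtain i j where ij: "i \<in> Field r" "j \<in> Field r" "a = \<phi> i" "b = \<phi> j"
      by (auto simp: J_def)
    then obtain k where "(i, k) \<in> r" "(j, k) \<in> r"
      using r unfolding directed_def by blast
    then show "\<exists>c. (a, c) \<in> s \<and> (b, c) \<in> s"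
      using ij up by blast
  qed
  moreover have "fst ` Field s \<subseteq> V"
    using xV unfolding F J_def \<phi>_def by auto
  moreover have "bo_fundamental E nrm s fst"
  proof -
    obtain q :: "'e rel" and e where
      q: "regulates E nrm (prod_rel r r) (\<lambda>(a, b). x a - x b) 0 q e"
      using fund by (auto simp: bo_fundamental_def bo_converges_def)
    have "\<exists>p\<in>Field (prod_rel s s). \<forall>p'. (p, p') \<in> prod_rel s s \<longrightarrow>
        nrm (0 - (case p' of (a, b) \<Rightarrow> fst a - fst b)) \<le> e \<gamma>" if \<gamma>: "\<gamma> \<in> Field q" for \<gamma>
    proof -
      obtain a b where ab: "(a, b) \<in> Field (prod_rel r r)" and
        le: "\<And>c d. ((a, b), (c, d)) \<in> prod_rel r r \<Longrightarrow> nrm (0 - (x c - x d)) \<le> e \<gamma>"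
        using q \<gamma> unfolding regulates_def by fastforce
      have "a \<in> Field r" "b \<in> Field r"
        using ab by (auto simp: prod_rel_def Field_def)
      then have "((\<phi> a, \<phi> b), (\<phi> a, \<phi> b)) \<in> prod_rel s s"
        using refl up by (auto simp: prod_rel_def)
      then have "(\<phi> a, \<phi> b) \<in> Field (prod_rel s s)"
        by (auto simp: Field_def)
      moreover have "nrm (0 - (fst c - fst d)) \<le> e \<gamma>"
        if cd: "((\<phi> a, \<phi> b), (c, d)) \<in> prod_rel s s" for c d
      proof -
        obtain c' d' where "(a, c') \<in> r" "fst c = x c'" "(b, d') \<in> r" "fst d = x d'"
          using cd down unfolding prod_rel_def by blast
        then show ?thesis
          using le[of c' d'] by (simp add: prod_rel_def)
      qed
      ultimately show ?thesis
        by (intro bexI[of _ "(\<phi> a, \<phi> b)"]) auto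
    qed
    then have "regulates E nrm (prod_rel s s) (\<lambda>(a, b). fst a - fst b) 0 q e"
      using q unfolding regulates_def by blast
    then show ?thesis
      unfolding bo_fundamental_def bo_converges_def by blast
  qed
  ultimately obtain v where v: "v \<in> V" "bo_converges E nrm s fst v"
    using assms unfolding bo_complete_def by blast
  then obtain q :: "'e rel" and e where q: "regulates E nrm s fst v q e"
    unfolding bo_converges_def by blast
  have "\<exists>a\<in>Field r. \<forall>b. (a, b) \<in> r \<longrightarrow> nrm (v - x b) \<le> e \<gamma>" if \<gamma>: "\<gamma> \<in> Field q" for \<gamma>
  proof -
    obtain p where p: "p \<in> Field s" "\<And>p'. (p, p') \<in> s \<Longrightarrow> nrm (v - fst p') \<le> e \<gamma>"
      using q \<gamma> unfolding regulates_def by blast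
    then obtain a where a: "a \<in> Field r" "p = \<phi> a"
      unfolding F J_def by blast
    have "nrm (v - x b) \<le> e \<gamma>" if "(a, b) \<in> r" for b
      using p(2)[of "\<phi> b"] up[OF that] a by (simp add: \<phi>_def)
    with a show ?thesis by blast
  qed
  then have "regulates E nrm r x v q e"
    using q unfolding regulates_def by blast
  with v(1) show "\<exists>v\<in>V. bo_converges E nrm r x v"
    unfolding bo_converges_def by blast
qed


section \<open>Abstract and dominated Uryson operators\<close>

definition uryson :: "('e::{ordered_real_vector, lattice_ab_group_add_abs} \<Rightarrow>
    'f::{ordered_real_vector, lattice}) \<Rightarrow> bool"
  where "uryson S \<longleftrightarrow>
    (\<forall>x y. inf \<bar>x\<bar> \<bar>y\<bar> = 0 \<longrightarrow> S (x + y) = S x + S y) \<and>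
    (\<forall>A. bdd_below A \<and> bdd_above A \<longrightarrow> bdd_below (S ` A) \<and> bdd_above (S ` A))"

definition uryson_even :: "('e::{ordered_real_vector, lattice_ab_group_add_abs} \<Rightarrow>
    'f::{ordered_real_vector, lattice}) set"
  where "uryson_even = {S. uryson S \<and> (\<forall>x. S (- x) = S x)}"

definition dominant :: "('v::real_vector \<Rightarrow> 'e::{ordered_real_vector, lattice_ab_group_add_abs}) \<Rightarrow>
    ('w::real_vector \<Rightarrow> 'f::{ordered_real_vector, lattice}) \<Rightarrow>
    ('v \<Rightarrow> 'w) \<Rightarrow> ('e \<Rightarrow> 'f) \<Rightarrow> bool"
  where "dominant nV nW T S \<longleftrightarrow>
    S \<in> uryson_even \<and> (\<forall>x. 0 \<le> S x) \<and> (\<forall>v. nW (T v) \<le> S (nV v))"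

definition dominated_uryson ::
  "('v::real_vector \<Rightarrow> 'e::{ordered_real_vector, lattice_ab_group_add_abs}) \<Rightarrow>
    ('w::real_vector \<Rightarrow> 'f::{ordered_real_vector, lattice}) \<Rightarrow> ('v \<Rightarrow> 'w) set"
  where "dominated_uryson nV nW =
    {T. (\<forall>u v. inf (nV u) (nV v) = 0 \<longrightarrow> T (u + v) = T u + T v) \<and> (\<exists>S. dominant nV nW T S)}"

definition exact_dominant ::
  "('v::real_vector \<Rightarrow> 'e::{ordered_real_vector, lattice_ab_group_add_abs}) \<Rightarrow>
    ('w::real_vector \<Rightarrow> 'f::{ordered_real_vector, lattice}) \<Rightarrow> ('v \<Rightarrow> 'w) \<Rightarrow> 'e \<Rightarrow> 'f"
  where "exact_dominant nV nW T = (LEAST S. dominant nV nW T S)"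

end

theory Submission
  imports Defs
begin

text \<open>
  The exact dominant of a dominated operator \<open>T\<close> is computed from \<open>T\<close> alone: its value at \<open>e\<close> is
  the supremum of the sums \<open>\<Sum> \<parallel>T v\<^sub>i\<parallel>\<close> over finite families of pairwise disjoint \<open>v\<^sub>i\<close> whose norms
  add up to a fragment of \<open>\<bar>e\<bar>\<close>. Such a sum is below \<open>S e\<close> for every dominant \<open>S\<close>, and
  decomposability of \<open>V\<close> makes the supremum orthogonally additive, so it is the least dominant
  (\<open>exact_dominant\<close>). The axioms of a vector norm follow from leastness. The same supremum over
  fragments, taken of a single operator, is its positive part, which makes the even abstract
  Uryson operators a vector lattice; they are given a type of their own, \<open>uryson_op\<close>.

  Everything that has to be constructed in \<open>W\<close> comes from one statement, \<open>centre_exists\<close>: if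
  \<open>\<parallel>w\<^sub>i - w\<^sub>j\<parallel> \<le> f\<^sub>i + f\<^sub>j\<close> for all \<open>i\<close>, \<open>j\<close> and the infimum of the \<open>f\<^sub>i\<close> is \<open>0\<close>, then some \<open>x\<close> has
  \<open>\<parallel>x - w\<^sub>i\<parallel> \<le> f\<^sub>i\<close> for every \<open>i\<close>. As the \<open>f\<^sub>i\<close> are in general not directed
  downwards, the \<open>w\<^sub>i\<close> themselves need not contain a convergent net; elements that approximate the
  family are mixed along bands of \<open>F\<close> instead, which makes them a (bo)-fundamental net.

  Completeness: if a net of operators is (bo)-fundamental with regulator \<open>e\<close>, then at every
  point \<open>v\<close> its tails satisfy the hypothesis of \<open>centre_exists\<close> with the radii \<open>e \<gamma> \<parallel>v\<parallel>\<close>, because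
  infima of decreasing nets of operators are pointwise. The centres form the limit operator.

  Decomposability: let \<open>\<parallel>T\<parallel> = S\<^sub>1 + S\<^sub>2\<close>. It suffices to find an orthogonally additive \<open>A\<close> with
  \<open>\<parallel>A v\<parallel> \<le> S\<^sub>1 \<parallel>v\<parallel>\<close> and \<open>\<parallel>T v - A v\<parallel> \<le> S\<^sub>2 \<parallel>v\<parallel>\<close>, since then \<open>\<parallel>A\<parallel> \<le> S\<^sub>1\<close>, \<open>\<parallel>T - A\<parallel> \<le> S\<^sub>2\<close> and the
  triangle inequality forces equality in both. If \<open>S\<^sub>1 \<and> S\<^sub>2 = 0\<close>, then for each \<open>v\<close> the
  elements \<open>f u = S\<^sub>1 \<parallel>v - u\<parallel> + S\<^sub>2 \<parallel>u\<parallel>\<close>, where \<open>u\<close> ranges over the \<open>u \<perp> v - u\<close>, have infimum \<open>0\<close>, and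
  \<open>A v\<close> is the common centre of the values \<open>T u\<close> with radii \<open>f u\<close> (\<open>split_disjoint\<close>). In general, cut \<open>S\<^sub>1 + S\<^sub>2\<close> into the part \<open>R\<close>
  in the band of \<open>(S\<^sub>1 - S\<^sub>2)\<^sup>+\<close> and the disjoint rest \<open>Q\<close>. Then \<open>R \<le> 2 S\<^sub>1\<close> and \<open>Q \<le> 2 S\<^sub>2\<close>, so half of the
  disjoint splitting respects \<open>S\<^sub>1\<close> and \<open>S\<^sub>2\<close> and distributes half of \<open>T\<close> (\<open>split_half\<close>). The other half
  of \<open>T\<close> is dominated by the sum of the remainders of \<open>S\<^sub>1\<close> and \<open>S\<^sub>2\<close>, so the step can be repeated,
  and the partial sums converge geometrically (\<open>split_dominated\<close>).
\<close>

section \<open>Disjointness in lattice-ordered groups\<close>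

text \<open>The lattice-group identities are needed at types that are ordered groups and lattices without
  being declared members of \<^class>\<open>lattice_ab_group_add\<close>, such as the conditionally complete value
  space. The four rules below push negations and differences through infima and suprema, which
  would hide the disjointness conditions that the proofs rewrite with.\<close>
interpretation lgroup: lattice_ab_group_add
  "plus :: 'a::{ordered_ab_group_add, lattice} \<Rightarrow> _" 0 minus uminus less_eq less inf sup
  by unfold_locales

declare lgroup.neg_inf_eq_sup [simp del] lgroup.neg_sup_eq_inf [simp del]
  lgroup.diff_inf_eq_sup [simp del] lgroup.diff_sup_eq_inf [simp del]

lemma disjoint_nonneg:
  fixes a b :: "'a::{ordered_ab_group_add, lattice}"
  assumes "inf a b = 0"
  shows "0 \<le> a" "0 \<le> b"
  using inf.cobounded1[of a b] inf.cobounded2[of a b] assms by simp_all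

lemma disjoint_mono:
  fixes a b :: "'a::{ordered_ab_group_add, lattice}"
  assumes "inf a b = 0" "0 \<le> c" "c \<le> a" "0 \<le> d" "d \<le> b"
  shows "inf c d = 0"
  using inf_mono[OF assms(3,5)] assms by (intro order.antisym) auto

lemma disjoint_self:
  fixes a :: "'a::{ordered_ab_group_add, lattice}"
  assumes "inf a b = 0" "c \<le> a" "c \<le> b"
  shows "c \<le> 0"
  using inf.boundedI[OF assms(2,3)] assms(1) by simp

lemma disjoint_add_eq_sup:
  fixes a b :: "'a::{ordered_ab_group_add, lattice}"
  assumes "inf a b = 0"
  shows "a + b = sup a b"
  using lgroup.add_eq_inf_sup[of a b] assms by simp

lemma diff_inf_eq_pos_part:
  fixes a b :: "'a::{ordered_ab_group_add, lattice}"
  shows "a - inf a b = sup (a - b) 0"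
  by (simp add: lgroup.diff_inf_eq_sup lgroup.add_sup_distrib_left sup.commute)

text \<open>With \<open>t = inf (p + q) a\<close>, the part of \<open>t\<close> that exceeds \<open>p\<close> is at most \<open>q\<close> and at most \<open>a\<close>.\<close>
lemma inf_add_le:
  fixes p q a :: "'a::{ordered_ab_group_add, lattice}"
  assumes "0 \<le> p" "0 \<le> q" "0 \<le> a"
  shows "inf (p + q) a \<le> inf p a + inf q a"
proof -
  define t where "t = inf (p + q) a"
  have t: "0 \<le> t" "t \<le> p + q" "t \<le> a"
    using assms by (auto simp: t_def)
  have "t - inf t p = sup (t - p) 0"
    by (rule diff_inf_eq_pos_part)
  also have "\<dots> \<le> inf q a"
    using t assms order_trans[OF _ t(3), of "t - p"] by (auto simp: algebra_simps)
  finally have "t \<le> inf q a + inf t p"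
    by (simp only: diff_le_eq)
  also have "\<dots> \<le> inf q a + inf p a"
    using t by (intro add_left_mono) (auto intro: le_infI1 le_infI2)
  finally show ?thesis
    by (simp add: t_def add.commute)
qed

lemma disjoint_add:
  fixes p q a :: "'a::{ordered_ab_group_add, lattice}"
  assumes "inf p a = 0" "inf q a = 0"
  shows "inf (p + q) a = 0"
  using inf_add_le[of p q a] disjoint_nonneg[OF assms(1)] disjoint_nonneg[OF assms(2)] assms
  by (intro order.antisym) auto

lemma disjoint_add_right:
  fixes p q a :: "'a::{ordered_ab_group_add, lattice}"
  assumes "inf a p = 0" "inf a q = 0"
  shows "inf a (p + q) = 0"
  using disjoint_add[of p a q] assms by (simp add: inf.commute)

lemma inf_add_of_disjoint:
  fixes p q a :: "'a::{ordered_ab_group_add, lattice}"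
  assumes "inf p q = 0" "0 \<le> a"
  shows "inf (p + q) a = inf p a + inf q a"
proof (rule order.antisym)
  note nn = disjoint_nonneg[OF assms(1)]
  show "inf (p + q) a \<le> inf p a + inf q a"
    using nn assms by (intro inf_add_le)
  have "inf (inf p a) (inf q a) = 0"
    using nn assms by (intro disjoint_mono[OF assms(1)]) auto
  then have "inf p a + inf q a = sup (inf p a) (inf q a)"
    by (rule disjoint_add_eq_sup)
  also have "\<dots> \<le> inf (p + q) a"
    using nn by (simp add: le_infI1 add_increasing add_increasing2)
  finally show "inf p a + inf q a \<le> inf (p + q) a" .
qed

text \<open>The condition also gives \<open>0 \<le> a\<close> and \<open>a \<le> e\<close>, since a zero infimum makes both arguments
  nonnegative; hence only nonnegative \<open>e\<close> have fragments.\<close>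
definition fragment :: "'a::{ordered_ab_group_add, lattice} \<Rightarrow> 'a \<Rightarrow> bool"
  where "fragment a e \<longleftrightarrow> inf a (e - a) = 0"

lemma fragment_bounds:
  assumes "fragment a e"
  shows "0 \<le> a" "a \<le> e"
  using disjoint_nonneg[of a "e - a"] assms by (auto simp: fragment_def)

lemma fragment_zero: "0 \<le> e \<Longrightarrow> fragment 0 e"
  by (auto simp: fragment_def inf.absorb1)

lemma fragment_self: "0 \<le> e \<Longrightarrow> fragment e e"
  by (auto simp: fragment_def inf.absorb2)

lemma fragment_diff: "fragment a e \<Longrightarrow> fragment (e - a) e"
  by (simp add: fragment_def inf.commute)

lemma fragment_add:
  assumes "fragment a x" "fragment b y" "inf x y = 0"
  shows "inf a b = 0" "fragment (a + b) (x + y)"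
proof -
  note fb = fragment_bounds[OF assms(1)] fragment_bounds[OF assms(2)]
  show "inf a b = 0"
    using fb by (intro disjoint_mono[OF assms(3)])
  have 1: "inf a (y - b) = 0" "inf (x - a) b = 0"
    using fb by (auto intro!: disjoint_mono[OF assms(3)] simp: algebra_simps)
  have "inf (a + b) ((x - a) + (y - b)) = 0"
    using 1 assms unfolding fragment_def
    by (intro disjoint_add) (auto intro!: disjoint_add_right simp: inf.commute)
  then show "fragment (a + b) (x + y)"
    unfolding fragment_def by (simp add: algebra_simps)
qed

text \<open>The heart of the matter is that cutting \<open>c\<close> by any \<open>u\<close> with \<open>0 \<le> u \<le> x + y\<close> leaves a fragment of \<open>u\<close>:
  since \<open>c\<close> and \<open>x + y - c\<close> are disjoint with sum above \<open>u\<close>, they cut \<open>u\<close> into two disjoint pieces.\<close>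
lemma fragment_split:
  assumes "fragment c (x + y)" "inf x y = 0"
  shows "fragment (inf c x) x" "fragment (inf c y) y"
    "c = inf c x + inf c y" "inf (inf c x) (inf c y) = 0"
proof -
  note nn = disjoint_nonneg[OF assms(2)]
  note fb = fragment_bounds[OF assms(1)]
  have frag: "fragment (inf c u) u" if u: "0 \<le> u" "u \<le> x + y" for u
  proof -
    have "inf c (x + y - c) = 0"
      using assms(1) by (simp add: fragment_def)
    from inf_add_of_disjoint[OF this u(1)]
    have "u = inf c u + inf (x + y - c) u"
      using u by (simp add: inf.absorb2)
    then have "u - inf c u = inf (x + y - c) u"
      by (metis add_diff_cancel_left')
    moreover have "inf (inf c u) (inf (x + y - c) u) = 0"
      using assms(1)[unfolded fragment_def] by (rule disjoint_mono) (use u fb in auto)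
    ultimately show ?thesis
      by (simp add: fragment_def)
  qed
  show "fragment (inf c x) x" "fragment (inf c y) y"
    using nn by (auto intro!: frag)
  show "c = inf c x + inf c y"
    using inf_add_of_disjoint[OF assms(2) fb(1)] fb(2)
    by (simp add: inf.commute inf.absorb1 inf.absorb2)
  show "inf (inf c x) (inf c y) = 0"
    using nn fb by (intro disjoint_mono[OF assms(2)]) auto
qed

lemma pos_neg_parts_disjoint:
  fixes d :: "'a::{ordered_ab_group_add, lattice}"
  shows "inf (sup d 0) (sup (- d) 0) = 0"
proof -
  have "sup d 0 - d = sup (- d) 0"
    using lgroup.add_sup_distrib_right[of d 0 "- d"] by (simp add: sup.commute)
  then have "sup (- d) 0 = sup d 0 - d" ..
  then have "inf (sup d 0) (sup (- d) 0) = sup d 0 - sup 0 d"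
    by (simp add: lgroup.diff_sup_eq_inf lgroup.add_inf_distrib_left inf.commute)
  then show ?thesis
    by (simp add: sup.commute)
qed

text \<open>This is how band arguments are phrased without band projections: an inequality holds if its
  excess is bounded by two disjoint elements.\<close>
lemma le_of_diff_bounded_by_disjoint:
  fixes a b :: "'a::{ordered_ab_group_add, lattice}"
  assumes "inf p q = 0" "a - b \<le> p" "a - b \<le> q"
  shows "a \<le> b"
  using disjoint_self[OF assms] by simp

text \<open>Both the absolute value and a lattice norm are additive on disjoint elements. By the triangle
  inequality \<open>N u \<le> N (u + v) + N v\<close>, and the part of \<open>N u\<close> below \<open>N v\<close> vanishes, so \<open>N u \<le> N (u + v)\<close>;
  the sum of two disjoint elements is their supremum.\<close>
lemma subadditive_add_disjoint:
  fixes N :: "'v::ab_group_add \<Rightarrow> 'e::{ordered_ab_group_add, lattice}"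
  assumes nonneg: "\<And>v. 0 \<le> N v" and minus: "\<And>v. N (- v) = N v"
    and triangle: "\<And>v w. N (v + w) \<le> N v + N w"
    and disj: "inf (N x) (N y) = 0"
  shows "N (x + y) = N x + N y"
proof (rule order.antisym)
  have le: "N u \<le> N (u + v)" if uv: "inf (N u) (N v) = 0" for u v
  proof -
    have "N u \<le> N (u + v) + N v"
      using triangle[of "u + v" "- v"] by (simp add: minus)
    then have "N u \<le> inf (N (u + v) + N v) (N u)"
      by simp
    also have "\<dots> \<le> inf (N (u + v)) (N u) + inf (N v) (N u)"
      by (intro inf_add_le nonneg)
    also have "\<dots> = inf (N (u + v)) (N u)"
      using uv by (simp add: inf.commute)
    finally show ?thesis
      by simp
  qed
  have "N x \<le> N (x + y)" "N y \<le> N (x + y)"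
    using le[of x y] le[of y x] disj by (simp_all add: inf.commute add.commute)
  then show "N x + N y \<le> N (x + y)"
    unfolding disjoint_add_eq_sup[OF disj] by simp
qed (rule triangle)

section \<open>Components in principal bands\<close>

text \<open>\<open>e\<close> is the component of \<open>x\<close> in the band generated by \<open>h\<close>. It is characterised as a least upper
  bound, because it is needed both in the value space and in the lattice of operators, where only
  some suprema are at hand.\<close>
locale band_component =
  fixes h x e :: "'a::{ordered_real_vector, lattice}"
  assumes h_nonneg: "0 \<le> h" and x_nonneg: "0 \<le> x"
    and upper: "inf (real n *\<^sub>R h) x \<le> e"
    and least: "(\<And>n. inf (real n *\<^sub>R h) x \<le> y) \<Longrightarrow> e \<le> y"
begin

lemma nonneg: "0 \<le> e"
  using upper[of 0] x_nonneg by (simp add: inf.absorb1)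

lemma le: "e \<le> x"
  by (rule least) simp

text \<open>If \<open>y \<ge> 0\<close> lies below both \<open>h\<close> and \<open>x - e\<close>, adding \<open>y\<close> to the \<open>n\<close>-th member of the increasing sequence
  with supremum \<open>e\<close> stays below the next member; so \<open>e + y \<le> e\<close>.\<close>
lemma disjoint_rest: "inf h (x - e) = 0"
proof -
  define y where "y = inf h (x - e)"
  have "0 \<le> y"
    using h_nonneg le by (simp add: y_def)
  have "inf (real n *\<^sub>R h) x + y \<le> e" for n
  proof -
    have "inf (real n *\<^sub>R h) x + y \<le> real n *\<^sub>R h + h"
      by (intro add_mono) (auto simp: y_def)
    moreover have "inf (real n *\<^sub>R h) x + y \<le> e + (x - e)"
      by (intro add_mono upper) (auto simp: y_def)
    ultimately have "inf (real n *\<^sub>R h) x + y \<le> inf (real (Suc n) *\<^sub>R h) x"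
      by (simp add: algebra_simps)
    with upper[of "Suc n"] show ?thesis
      by (rule order_trans[rotated])
  qed
  then have "e \<le> e - y"
    by (intro least) (simp add: algebra_simps)
  with \<open>0 \<le> y\<close> show ?thesis
    unfolding y_def by (intro order.antisym) simp_all
qed

text \<open>Each member of the sequence is disjoint to \<open>z\<close>, so its sum with \<open>y = inf z e\<close> is a supremum and
  stays below \<open>e\<close>; again \<open>e + y \<le> e\<close>.\<close>
lemma disjoint_component:
  assumes "inf z h = 0"
  shows "inf z e = 0"
proof -
  note z = disjoint_nonneg[OF assms]
  define y where "y = inf z e"
  have y: "0 \<le> y"
    using z nonneg by (simp add: y_def)
  have "inf (real n *\<^sub>R h) x + y \<le> e" for n
  proof -
    have "inf (real n *\<^sub>R h) z = 0"
    proof (induction n)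
      case (Suc n)
      then show ?case
        using disjoint_add[of h z "real n *\<^sub>R h"] assms by (simp add: algebra_simps inf.commute)
    qed (use z in \<open>simp add: inf.absorb1\<close>)
    then have "inf (inf (real n *\<^sub>R h) x) y = 0"
      by (rule disjoint_mono) (use y h_nonneg x_nonneg in \<open>auto simp: y_def scaleR_nonneg_nonneg\<close>)
    from disjoint_add_eq_sup[OF this] show ?thesis
      using upper by (simp add: y_def)
  qed
  then have "e \<le> e - y"
    by (intro least) (simp add: algebra_simps)
  with y show ?thesis
    unfolding y_def by (intro order.antisym) simp_all
qed

end

text \<open>Cutting \<open>a + b\<close> along the band of \<open>(a - b)\<^sup>+\<close> separates, up to a factor of two, the region where \<open>a\<close>
  dominates \<open>b\<close> from the region where \<open>b\<close> dominates \<open>a\<close>.\<close>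
lemma band_component_bounds:
  fixes a b :: "'a::{ordered_real_vector, lattice}"
  assumes "band_component (sup (a - b) 0) (a + b) e" "0 \<le> a" "0 \<le> b"
  shows "inf e (a + b - e) = 0" "e \<le> a + a" "a + b - e \<le> b + b"
proof -
  interpret band_component "sup (a - b) 0" "a + b" e by fact
  have rest: "inf (sup (a - b) 0) (a + b - e) = 0" by (rule disjoint_rest)
  then show "inf e (a + b - e) = 0"
    using disjoint_component[of "a + b - e"] by (simp add: inf.commute)
  have "inf (sup (b - a) 0) e = 0"
    using pos_neg_parts_disjoint[of "a - b"] by (intro disjoint_component) (simp add: inf.commute)
  moreover have "e - (a + a) \<le> sup (b - a) 0"
    using le by (intro le_supI1) (simp add: algebra_simps)
  moreover have "e - (a + a) \<le> e"
    using assms by (simp add: diff_le_eq)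
  ultimately show "e \<le> a + a"
    by (rule le_of_diff_bounded_by_disjoint)
  have "a + b - e - (b + b) \<le> sup (a - b) 0"
    using nonneg by (intro le_supI1) (simp add: algebra_simps)
  moreover have "a + b - e - (b + b) \<le> a + b - e"
    using assms by (simp add: diff_le_eq)
  ultimately show "a + b - e \<le> b + b"
    by (rule le_of_diff_bounded_by_disjoint[OF rest])
qed

section \<open>Even abstract Uryson operators\<close>

lemma abs_add_disjoint:
  fixes x y :: "'a::lattice_ab_group_add_abs"
  assumes "inf \<bar>x\<bar> \<bar>y\<bar> = 0"
  shows "\<bar>x + y\<bar> = \<bar>x\<bar> + \<bar>y\<bar>"
  by (rule subadditive_add_disjoint[where N = abs]) (simp_all add: abs_triangle_ineq assms)

lemma bdd_imp_abs_bound: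
  fixes A :: "'a::lattice_ab_group_add_abs set"
  assumes "bdd_below A" "bdd_above A"
  shows "\<exists>a. \<forall>x\<in>A. \<bar>x\<bar> \<le> a"
proof -
  obtain l u where lu: "\<And>x. x \<in> A \<Longrightarrow> l \<le> x \<and> x \<le> u"
    using assms unfolding bdd_below_def bdd_above_def by blast
  have "\<bar>x\<bar> \<le> \<bar>l\<bar> + \<bar>u\<bar>" if "x \<in> A" for x
  proof (rule abs_leI)
    show "x \<le> \<bar>l\<bar> + \<bar>u\<bar>"
      using lu[OF that] by (meson abs_ge_self abs_ge_zero add_increasing order_trans)
    have "- x \<le> - l"
      using lu[OF that] by simp
    then show "- x \<le> \<bar>l\<bar> + \<bar>u\<bar>"
      by (meson abs_ge_minus_self abs_ge_zero add_increasing2 order_trans)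
  qed
  then show ?thesis by blast
qed

context
  fixes S :: "'e::{ordered_real_vector, lattice_ab_group_add_abs} \<Rightarrow> 'f::{ordered_real_vector, lattice}"
  assumes S: "S \<in> uryson_even"
begin

lemma uryson_even_add: "inf \<bar>x\<bar> \<bar>y\<bar> = 0 \<Longrightarrow> S (x + y) = S x + S y"
  using S by (simp add: uryson_even_def uryson_def)

lemma uryson_even_add_pos: "inf x y = 0 \<Longrightarrow> S (x + y) = S x + S y"
  using disjoint_nonneg[of x y] by (intro uryson_even_add) simp

lemma uryson_even_minus: "S (- x) = S x"
  using S by (simp add: uryson_even_def)

lemma uryson_even_zero: "S 0 = 0"
  using uryson_even_add[of 0 0] by simp

lemma uryson_even_bounded: "\<exists>l u. \<forall>x. \<bar>x\<bar> \<le> a \<longrightarrow> l \<le> S x \<and> S x \<le> u"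
proof -
  have "bdd_below {x. \<bar>x\<bar> \<le> a}"
    by (rule bdd_belowI[of _ "- a"]) (use abs_le_D2 minus_le_iff in blast)
  moreover have "bdd_above {x. \<bar>x\<bar> \<le> a}"
    by (rule bdd_aboveI[of _ a]) (auto dest: abs_le_D1)
  moreover have "uryson S"
    using S by (simp add: uryson_even_def)
  then have "bdd_below A \<and> bdd_above A \<longrightarrow> bdd_below (S ` A) \<and> bdd_above (S ` A)" for A
    unfolding uryson_def by (elim conjE) (erule spec)
  ultimately have "bdd_below (S ` {x. \<bar>x\<bar> \<le> a}) \<and> bdd_above (S ` {x. \<bar>x\<bar> \<le> a})"
    by simp
  then obtain l u where "\<And>y. y \<in> S ` {x. \<bar>x\<bar> \<le> a} \<Longrightarrow> l \<le> y" "\<And>y. y \<in> S ` {x. \<bar>x\<bar> \<le> a} \<Longrightarrow> y \<le> u"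
    unfolding bdd_below_def bdd_above_def by metis
  then show ?thesis
    by (intro exI[of _ l] exI[of _ u]) simp
qed

text \<open>Evenness removes the sign of the negative part, and the two parts are disjoint.\<close>
lemma uryson_even_abs: "S \<bar>x\<bar> = S x"
proof -
  define p q where "p = sup x 0" and "q = sup (- x) 0"
  have pq: "inf p q = 0"
    unfolding p_def q_def by (rule pos_neg_parts_disjoint)
  note nn = disjoint_nonneg[OF pq]
  have "x = p - q"
    using lgroup.prts[of x] lgroup.pprt_neg[of x] unfolding p_def q_def lgroup.pprt_def
    by (simp add: algebra_simps)
  have "S (p + - q) = S p + S (- q)"
    using pq nn by (intro uryson_even_add) simp
  also have "\<dots> = S p + S q"
    by (simp add: uryson_even_minus)
  also have "\<dots> = S (p + q)"
    using pq by (simp add: uryson_even_add_pos)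
  also have "p + q = \<bar>x\<bar>"
    using abs_add_disjoint[of p "- q"] pq nn \<open>x = p - q\<close> by simp
  finally show ?thesis
    using \<open>x = p - q\<close> by simp
qed

lemma uryson_even_fragment_mono:
  assumes "\<And>x. 0 \<le> S x" "fragment a e"
  shows "S a \<le> S e"
  using uryson_even_add_pos[of a "e - a"] assms by (simp add: fragment_def)

lemma uryson_even_fragment_diff:
  assumes "fragment a e"
  shows "S (e - a) = S e - S a"
  using uryson_even_add_pos[of a "e - a"] assms by (simp add: fragment_def)

end

lemma uryson_evenI:
  fixes S :: "'e::{ordered_real_vector, lattice_ab_group_add_abs} \<Rightarrow> 'f::{ordered_real_vector, lattice}"
  assumes "\<And>x y. inf \<bar>x\<bar> \<bar>y\<bar> = 0 \<Longrightarrow> S (x + y) = S x + S y"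
    and "\<And>x. S (- x) = S x"
    and bounded: "\<And>a. \<exists>l u. \<forall>x. \<bar>x\<bar> \<le> a \<longrightarrow> l \<le> S x \<and> S x \<le> u"
  shows "S \<in> uryson_even"
proof -
  have "bdd_below (S ` A) \<and> bdd_above (S ` A)" if A: "bdd_below A" "bdd_above A" for A
  proof -
    obtain a where a: "\<forall>x\<in>A. \<bar>x\<bar> \<le> a"
      using bdd_imp_abs_bound[OF A] by blast
    obtain l u where "\<forall>x. \<bar>x\<bar> \<le> a \<longrightarrow> l \<le> S x \<and> S x \<le> u"
      using bounded by blast
    with a show ?thesis
      unfolding bdd_below_def bdd_above_def by blast
  qed
  with assms(1,2) show ?thesis
    by (auto simp: uryson_even_def uryson_def)
qed

lemma subspace_uryson_even:
  "subspace (uryson_even :: ('e::{ordered_real_vector, lattice_ab_group_add_abs} \<Rightarrow>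
     'f::{ordered_real_vector, lattice}) set)"
proof (rule subspaceI)
  show "0 \<in> (uryson_even :: ('e \<Rightarrow> 'f) set)"
    by (rule uryson_evenI) auto
next
  fix S T :: "'e \<Rightarrow> 'f" assume S: "S \<in> uryson_even" and T: "T \<in> uryson_even"
  show "S + T \<in> uryson_even"
  proof (rule uryson_evenI)
    fix a :: 'e
    obtain l u l' u' where "\<forall>x. \<bar>x\<bar> \<le> a \<longrightarrow> l \<le> S x \<and> S x \<le> u"
        "\<forall>x. \<bar>x\<bar> \<le> a \<longrightarrow> l' \<le> T x \<and> T x \<le> u'"
      using uryson_even_bounded[OF S, of a] uryson_even_bounded[OF T, of a] by blast
    then show "\<exists>l u. \<forall>x. \<bar>x\<bar> \<le> a \<longrightarrow> l \<le> (S + T) x \<and> (S + T) x \<le> u"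
      by (intro exI[of _ "l + l'"] exI[of _ "u + u'"]) (auto intro: add_mono)
  qed (simp_all add: uryson_even_add[OF S] uryson_even_add[OF T] uryson_even_minus[OF S]
      uryson_even_minus[OF T] algebra_simps)
next
  fix c and S :: "'e \<Rightarrow> 'f" assume S: "S \<in> uryson_even"
  show "c *\<^sub>R S \<in> uryson_even"
  proof (rule uryson_evenI)
    fix a :: 'e
    obtain l u where lu: "\<forall>x. \<bar>x\<bar> \<le> a \<longrightarrow> l \<le> S x \<and> S x \<le> u"
      using uryson_even_bounded[OF S, of a] by blast
    show "\<exists>l u. \<forall>x. \<bar>x\<bar> \<le> a \<longrightarrow> l \<le> (c *\<^sub>R S) x \<and> (c *\<^sub>R S) x \<le> u"
    proof (cases "0 \<le> c")
      case True
      with lu show ?thesis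
        by (intro exI[of _ "c *\<^sub>R l"] exI[of _ "c *\<^sub>R u"])
          (auto simp: scaleR_fun_def intro: scaleR_left_mono)
    next
      case False
      with lu show ?thesis
        by (intro exI[of _ "c *\<^sub>R u"] exI[of _ "c *\<^sub>R l"])
          (auto simp: scaleR_fun_def intro: scaleR_left_mono_neg)
    qed
  qed (simp_all add: uryson_even_add[OF S] uryson_even_minus[OF S] scaleR_fun_def algebra_simps)
qed

section \<open>Operators defined as suprema over fragments\<close>

text \<open>A relation \<open>G\<close> lists candidate values \<open>s\<close> for nonnegative elements \<open>c\<close>. If the candidates can be
  added over disjoint elements and cut along disjoint decompositions, then taking suprema over all
  fragments yields an even Uryson operator. The positive part of an operator and the exact dominant
  are both of this form.\<close>
definition fragment_sup :: "('e::{ordered_real_vector, lattice_ab_group_add_abs} \<times>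
    'f::{ordered_real_vector, conditionally_complete_lattice}) set \<Rightarrow> 'e \<Rightarrow> 'f"
  where "fragment_sup G e = Sup {s. \<exists>c. fragment c \<bar>e\<bar> \<and> (c, s) \<in> G}"

locale additive_relation =
  fixes G :: "('e::{ordered_real_vector, lattice_ab_group_add_abs} \<times>
    'f::{ordered_real_vector, conditionally_complete_lattice}) set"
  assumes zero: "(0, 0) \<in> G"
    and add: "(a, s) \<in> G \<Longrightarrow> (b, t) \<in> G \<Longrightarrow> inf a b = 0 \<Longrightarrow> (a + b, s + t) \<in> G"
    and split: "(a + b, s) \<in> G \<Longrightarrow> inf a b = 0 \<Longrightarrow>
      \<exists>t u. (a, t) \<in> G \<and> (b, u) \<in> G \<and> s \<le> t + u"
    and bounded: "\<exists>u. \<forall>c s. 0 \<le> c \<longrightarrow> c \<le> a \<longrightarrow> (c, s) \<in> G \<longrightarrow> s \<le> u"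
begin

lemma sup_upper:
  assumes "fragment c \<bar>e\<bar>" "(c, s) \<in> G"
  shows "s \<le> fragment_sup G e"
  unfolding fragment_sup_def
proof (rule cSup_upper)
  obtain u where "\<forall>c s. 0 \<le> c \<longrightarrow> c \<le> \<bar>e\<bar> \<longrightarrow> (c, s) \<in> G \<longrightarrow> s \<le> u"
    using bounded by blast
  then show "bdd_above {s. \<exists>c. fragment c \<bar>e\<bar> \<and> (c, s) \<in> G}"
    by (intro bdd_aboveI[of _ u]) (auto dest: fragment_bounds)
qed (use assms in blast)

lemma sup_least:
  assumes "\<And>c s. fragment c \<bar>e\<bar> \<Longrightarrow> (c, s) \<in> G \<Longrightarrow> s \<le> y"
  shows "fragment_sup G e \<le> y"
  unfolding fragment_sup_def
  by (rule cSup_least) (use assms zero fragment_zero[of "\<bar>e\<bar>"] in auto)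

lemma sup_nonneg: "0 \<le> fragment_sup G e"
  by (rule sup_upper[OF fragment_zero zero]) simp

lemma sup_uryson_even: "fragment_sup G \<in> uryson_even"
proof (rule uryson_evenI)
  fix x y :: 'e
  assume xy: "inf \<bar>x\<bar> \<bar>y\<bar> = 0"
  note abs_xy = abs_add_disjoint[OF xy]
  show "fragment_sup G (x + y) = fragment_sup G x + fragment_sup G y"
  proof (rule order.antisym)
    show "fragment_sup G (x + y) \<le> fragment_sup G x + fragment_sup G y"
    proof (rule sup_least)
      fix c s assume "fragment c \<bar>x + y\<bar>" and cs: "(c, s) \<in> G"
      then have "fragment c (\<bar>x\<bar> + \<bar>y\<bar>)"
        by (simp add: abs_xy)
      note sp = fragment_split[OF this xy]
      obtain t u where tu: "(inf c \<bar>x\<bar>, t) \<in> G" "(inf c \<bar>y\<bar>, u) \<in> G" "s \<le> t + u"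
        using split[of "inf c \<bar>x\<bar>" "inf c \<bar>y\<bar>" s] sp cs by metis
      then have "t \<le> fragment_sup G x" "u \<le> fragment_sup G y"
        using sp by (auto intro: sup_upper)
      with tu(3) show "s \<le> fragment_sup G x + fragment_sup G y"
        by (meson add_mono order_trans)
    qed
    have "t + u \<le> fragment_sup G (x + y)"
      if "fragment a \<bar>x\<bar>" "(a, t) \<in> G" "fragment b \<bar>y\<bar>" "(b, u) \<in> G" for a b t u
      using fragment_add[OF that(1,3) xy] add[OF that(2,4)]
      by (intro sup_upper[of "a + b"]) (auto simp: abs_xy)
    then have "fragment_sup G x \<le> fragment_sup G (x + y) - u"
      if "fragment b \<bar>y\<bar>" "(b, u) \<in> G" for b u
      using that by (intro sup_least) (simp add: le_diff_eq)
    then have "fragment_sup G y \<le> fragment_sup G (x + y) - fragment_sup G x"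
      by (intro sup_least) (simp add: algebra_simps)
    then show "fragment_sup G x + fragment_sup G y \<le> fragment_sup G (x + y)"
      by (simp add: algebra_simps)
  qed
next
  fix x :: 'e
  show "fragment_sup G (- x) = fragment_sup G x"
    by (simp add: fragment_sup_def)
next
  fix a :: 'e
  obtain u where u: "\<forall>c s. 0 \<le> c \<longrightarrow> c \<le> a \<longrightarrow> (c, s) \<in> G \<longrightarrow> s \<le> u"
    using bounded by blast
  have "fragment_sup G x \<le> u" if "\<bar>x\<bar> \<le> a" for x
  proof (rule sup_least)
    fix c s assume "fragment c \<bar>x\<bar>" "(c, s) \<in> G"
    then show "s \<le> u"
      using u fragment_bounds[of c "\<bar>x\<bar>"] that order_trans by blast
  qed
  then show "\<exists>l u. \<forall>x. \<bar>x\<bar> \<le> a \<longrightarrow> l \<le> fragment_sup G x \<and> fragment_sup G x \<le> u"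
    using sup_nonneg by blast
qed

end

section \<open>The vector lattice of even abstract Uryson operators\<close>

definition uryson_pos_part :: "('e::{ordered_real_vector, lattice_ab_group_add_abs} \<Rightarrow>
    'f::{ordered_real_vector, conditionally_complete_lattice}) \<Rightarrow> 'e \<Rightarrow> 'f"
  where "uryson_pos_part S = fragment_sup {(c, S c) |c. True}"

lemma additive_relation_graph:
  fixes S :: "'e::{ordered_real_vector, lattice_ab_group_add_abs} \<Rightarrow>
    'f::{ordered_real_vector, conditionally_complete_lattice}"
  assumes "S \<in> uryson_even"
  shows "additive_relation {(c, S c) |c. True}"
proof
  fix a
  obtain l u where "\<forall>x. \<bar>x\<bar> \<le> a \<longrightarrow> l \<le> S x \<and> S x \<le> u"
    using uryson_even_bounded[OF assms] by blast
  then show "\<exists>u. \<forall>c s. 0 \<le> c \<longrightarrow> c \<le> a \<longrightarrow> (c, s) \<in> {(c, S c) |c. True} \<longrightarrow> s \<le> u"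
    by (intro exI[of _ u]) auto
qed (auto simp: uryson_even_zero[OF assms] uryson_even_add_pos[OF assms])

text \<open>A dominating positive \<open>T\<close> satisfies \<open>S c \<le> T c \<le> T \<bar>x\<bar>\<close> for every fragment \<open>c\<close> of \<open>\<bar>x\<bar>\<close>, which makes
  the supremum over fragments the least upper bound of \<open>S\<close> and \<open>0\<close> among the even operators.\<close>
lemma uryson_pos_part:
  fixes S :: "'e::{ordered_real_vector, lattice_ab_group_add_abs} \<Rightarrow>
    'f::{ordered_real_vector, conditionally_complete_lattice}"
  assumes S: "S \<in> uryson_even"
  shows "uryson_pos_part S \<in> uryson_even" "0 \<le> uryson_pos_part S" "S \<le> uryson_pos_part S"
    and "(\<And>c. fragment c \<bar>x\<bar> \<Longrightarrow> S c \<le> y) \<Longrightarrow> uryson_pos_part S x \<le> y"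
    and "T \<in> uryson_even \<Longrightarrow> 0 \<le> T \<Longrightarrow> S \<le> T \<Longrightarrow> uryson_pos_part S \<le> T"
proof -
  interpret additive_relation "{(c, S c) |c. True}"
    by (rule additive_relation_graph[OF S])
  show "uryson_pos_part S \<in> uryson_even" "0 \<le> uryson_pos_part S"
    using sup_uryson_even sup_nonneg by (simp_all add: uryson_pos_part_def le_fun_def)
  have "S \<bar>x\<bar> \<le> uryson_pos_part S x" for x
    unfolding uryson_pos_part_def by (rule sup_upper[OF fragment_self]) auto
  then show "S \<le> uryson_pos_part S"
    by (simp add: le_fun_def uryson_even_abs[OF S])
  show least: "uryson_pos_part S x \<le> y" if "\<And>c. fragment c \<bar>x\<bar> \<Longrightarrow> S c \<le> y" for x y
    unfolding uryson_pos_part_def by (rule sup_least) (use that in auto)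
  show "uryson_pos_part S \<le> T" if T: "T \<in> uryson_even" "0 \<le> T" "S \<le> T"
  proof (rule le_funI, rule least)
    fix x c :: 'e assume "fragment c \<bar>x\<bar>"
    then have "T c \<le> T \<bar>x\<bar>"
      using T by (intro uryson_even_fragment_mono) (auto simp: le_fun_def)
    then show "S c \<le> T x"
      using T(3) order_trans by (auto simp: le_fun_def uryson_even_abs[OF T(1)])
  qed
qed

text \<open>The lattice operations of this space are not the pointwise ones, which function types already
  carry. A separate type lets the lattice-group and band lemmas apply to operators.\<close>
typedef (overloaded) ('e, 'f) uryson_op =
  "uryson_even :: ('e::{ordered_real_vector, lattice_ab_group_add_abs} \<Rightarrow>
    'f::{ordered_real_vector, conditionally_complete_lattice}) set"
  morphisms app Abs_op
  using subspace_0[OF subspace_uryson_even] by blast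

setup_lifting type_definition_uryson_op

instantiation uryson_op :: ("{ordered_real_vector, lattice_ab_group_add_abs}",
    "{ordered_real_vector, conditionally_complete_lattice}") "{ordered_real_vector, lattice}"
begin

lift_definition zero_uryson_op :: "('a, 'b) uryson_op" is 0
  by (rule subspace_0[OF subspace_uryson_even])

lift_definition plus_uryson_op :: "('a, 'b) uryson_op \<Rightarrow> ('a, 'b) uryson_op \<Rightarrow> ('a, 'b) uryson_op"
  is "(+)" by (rule subspace_add[OF subspace_uryson_even])

lift_definition minus_uryson_op :: "('a, 'b) uryson_op \<Rightarrow> ('a, 'b) uryson_op \<Rightarrow> ('a, 'b) uryson_op"
  is "(-)" by (rule subspace_diff[OF subspace_uryson_even])

lift_definition uminus_uryson_op :: "('a, 'b) uryson_op \<Rightarrow> ('a, 'b) uryson_op"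
  is uminus by (rule subspace_neg[OF subspace_uryson_even])

lift_definition scaleR_uryson_op :: "real \<Rightarrow> ('a, 'b) uryson_op \<Rightarrow> ('a, 'b) uryson_op"
  is scaleR by (rule subspace_scale[OF subspace_uryson_even])

lift_definition less_eq_uryson_op :: "('a, 'b) uryson_op \<Rightarrow> ('a, 'b) uryson_op \<Rightarrow> bool"
  is "(\<le>)" .

lift_definition less_uryson_op :: "('a, 'b) uryson_op \<Rightarrow> ('a, 'b) uryson_op \<Rightarrow> bool"
  is "(<)" .

lift_definition sup_uryson_op :: "('a, 'b) uryson_op \<Rightarrow> ('a, 'b) uryson_op \<Rightarrow> ('a, 'b) uryson_op"
  is "\<lambda>S T. T + uryson_pos_part (S - T)"
  by (intro subspace_add[OF subspace_uryson_even] uryson_pos_part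
      subspace_diff[OF subspace_uryson_even])

lift_definition inf_uryson_op :: "('a, 'b) uryson_op \<Rightarrow> ('a, 'b) uryson_op \<Rightarrow> ('a, 'b) uryson_op"
  is "\<lambda>S T. S - uryson_pos_part (S - T)"
  by (intro subspace_diff[OF subspace_uryson_even] uryson_pos_part)

instance
proof
  note diff = subspace_diff[OF subspace_uryson_even]
  fix S T X :: "('a, 'b) uryson_op" and c d :: real
  show "S + T + X = S + (T + X)" "S + T = T + S" "0 + S = S" "- S + S = 0" "S - T = S + - T"
    by (transfer, simp)+
  show "c *\<^sub>R (S + T) = c *\<^sub>R S + c *\<^sub>R T" "(c + d) *\<^sub>R S = c *\<^sub>R S + d *\<^sub>R S"
    "c *\<^sub>R d *\<^sub>R S = (c * d) *\<^sub>R S" "1 *\<^sub>R S = S"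
    by (transfer, simp add: scaleR_add_left scaleR_add_right)+
  show "S < T \<longleftrightarrow> S \<le> T \<and> \<not> T \<le> S" "S \<le> S"
    by (transfer, auto)+
  show "S \<le> X" if "S \<le> T" "T \<le> X"
    using that by transfer (rule order_trans)
  show "S = T" if "S \<le> T" "T \<le> S"
    using that by transfer (rule order.antisym)
  show "X + S \<le> X + T" if "S \<le> T"
    using that by transfer (rule add_left_mono)
  show "c *\<^sub>R S \<le> c *\<^sub>R T" if "S \<le> T" "0 \<le> c"
    using that by transfer (rule scaleR_left_mono)
  show "c *\<^sub>R S \<le> d *\<^sub>R S" if "c \<le> d" "0 \<le> S"
    using that by transfer (rule scaleR_right_mono)
  have pos: "0 \<le> uryson_pos_part (S - T)" and le: "S \<le> T + uryson_pos_part (S - T)"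
    if "S \<in> uryson_even" "T \<in> uryson_even" for S T :: "'a \<Rightarrow> 'b"
    using uryson_pos_part(2,3)[OF diff[OF that]] by (simp_all add: diff_le_eq add.commute)
  show "inf S T \<le> S" "T \<le> sup S T"
    by (transfer, simp add: pos)+
  show "inf S T \<le> T" "S \<le> sup S T"
    by (transfer, simp add: le diff_le_eq)+
  show "S \<le> inf T X" if "S \<le> T" "S \<le> X"
    using that
  proof transfer
    fix S T X :: "'a \<Rightarrow> 'b"
    assume "S \<in> uryson_even" "T \<in> uryson_even" "X \<in> uryson_even" "S \<le> T" "S \<le> X"
    then have "uryson_pos_part (T - X) \<le> T - S"
      by (intro uryson_pos_part diff) (simp_all add: algebra_simps)
    then show "S \<le> T - uryson_pos_part (T - X)"
      by (simp add: algebra_simps)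
  qed
  show "sup T X \<le> S" if "T \<le> S" "X \<le> S"
    using that
  proof transfer
    fix S T X :: "'a \<Rightarrow> 'b"
    assume "S \<in> uryson_even" "T \<in> uryson_even" "X \<in> uryson_even" "T \<le> S" "X \<le> S"
    then have "uryson_pos_part (T - X) \<le> S - X"
      by (intro uryson_pos_part diff) (simp_all add: algebra_simps)
    then show "X + uryson_pos_part (T - X) \<le> S"
      by (simp add: algebra_simps)
  qed
qed

end

lemma app_mono: "R \<le> Q \<Longrightarrow> app R e \<le> app Q e"
  by (simp add: less_eq_uryson_op.rep_eq le_fun_def)

lemma app_nonneg: "0 \<le> R \<Longrightarrow> 0 \<le> app R e"
  using app_mono[of 0 R e] by (simp add: zero_uryson_op.rep_eq)

lemma app_fragment_mono: "0 \<le> R \<Longrightarrow> fragment a e \<Longrightarrow> app R a \<le> app R e"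
  by (rule uryson_even_fragment_mono[OF app]) (simp_all add: app_nonneg)

lemma app_scale: "app (c *\<^sub>R S) x = c *\<^sub>R app S x"
  by (simp add: scaleR_uryson_op.rep_eq scaleR_fun_def)

lemma app_surj: "S \<in> uryson_even \<Longrightarrow> \<exists>X. S = app X"
  by (metis Abs_op_inverse)
text \<open>Disjointness of operators in terms of values: the infimum of \<open>R\<close> and \<open>Q\<close> is
  \<open>R - (R - Q)\<^sup>+\<close>, whose value at \<open>e\<close> is the infimum of \<open>R (\<bar>e\<bar> - c) + Q c\<close> over the fragments \<open>c\<close>
  of \<open>\<bar>e\<bar>\<close>.\<close>
lemma disjoint_op_inf_zero:
  assumes "inf R Q = 0" "\<And>c. fragment c \<bar>e\<bar> \<Longrightarrow> y \<le> app R (\<bar>e\<bar> - c) + app Q c"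
  shows "y \<le> 0"
proof -
  have "app R - uryson_pos_part (app R - app Q) = 0"
    using assms(1) by (metis inf_uryson_op.rep_eq zero_uryson_op.rep_eq)
  then have "app R e = uryson_pos_part (app R - app Q) e"
    by (metis eq_iff_diff_eq_0)
  also have "\<dots> \<le> app R e - y"
  proof (rule uryson_pos_part(4))
    fix c assume c: "fragment c \<bar>e\<bar>"
    show "(app R - app Q) c \<le> app R e - y"
      using assms(2)[OF c] uryson_even_fragment_diff[OF app c, of R] uryson_even_abs[OF app, of R e]
      by (simp add: algebra_simps)
  qed (intro subspace_diff[OF subspace_uryson_even] app)
  finally show ?thesis
    by simp
qed

section \<open>Infima of decreasing nets and components of bands\<close>

lemma isLub_iff:
  "isLub E A s \<longleftrightarrow> s \<in> E \<and> (\<forall>a\<in>A. a \<le> s) \<and> (\<forall>y\<in>E. (\<forall>a\<in>A. a \<le> y) \<longrightarrow> s \<le> y)"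
  by (auto simp: isLub_def leastP_def isUb_def setle_def setge_def)

lemma isGlb_iff:
  "isGlb E A i \<longleftrightarrow> i \<in> E \<and> (\<forall>a\<in>A. i \<le> a) \<and> (\<forall>y\<in>E. (\<forall>a\<in>A. y \<le> a) \<longrightarrow> y \<le> i)"
  by (auto simp: isGlb_def greatestP_def isLb_def setle_def setge_def)

lemma directedD:
  assumes "directed r"
  shows "Field r \<noteq> {}"
    and "a \<in> Field r \<Longrightarrow> (a, a) \<in> r"
    and "(a, b) \<in> r \<Longrightarrow> (b, c) \<in> r \<Longrightarrow> (a, c) \<in> r"
    and "a \<in> Field r \<Longrightarrow> b \<in> Field r \<Longrightarrow> \<exists>c. (a, c) \<in> r \<and> (b, c) \<in> r"
  using assms by (auto simp: directed_def preorder_on_def refl_on_def dest: transD)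

text \<open>Unlike binary infima, infima of decreasing nets are pointwise: directedness allows one index to
  serve two disjoint summands at once.\<close>
lemma decreasing_net_inf_uryson_even:
  fixes S :: "'i \<Rightarrow> 'e::{ordered_real_vector, lattice_ab_group_add_abs} \<Rightarrow>
    'f::{ordered_real_vector, conditionally_complete_lattice}"
  assumes q: "directed q" and dec: "\<And>i j. (i, j) \<in> q \<Longrightarrow> S j \<le> S i"
    and S: "\<And>i. i \<in> Field q \<Longrightarrow> S i \<in> uryson_even" "\<And>i. i \<in> Field q \<Longrightarrow> 0 \<le> S i"
  shows "(\<lambda>x. INF i\<in>Field q. S i x) \<in> uryson_even"
    and "i \<in> Field q \<Longrightarrow> (INF i\<in>Field q. S i x) \<le> S i x"
    and "(\<And>i. i \<in> Field q \<Longrightarrow> y \<le> S i x) \<Longrightarrow> y \<le> (INF i\<in>Field q. S i x)"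
proof -
  define H where "H x = (INF i\<in>Field q. S i x)" for x
  note ne = directedD(1)[OF q]
  have lower: "H x \<le> S i x" if "i \<in> Field q" for i x
    unfolding H_def using S(2) that by (intro cINF_lower bdd_belowI[of _ 0]) (auto simp: le_fun_def)
  have greatest: "y \<le> H x" if "\<And>i. i \<in> Field q \<Longrightarrow> y \<le> S i x" for x y
    unfolding H_def using ne that by (intro cINF_greatest)
  have "H \<in> uryson_even"
  proof (rule uryson_evenI)
    fix x y :: 'e
    assume xy: "inf \<bar>x\<bar> \<bar>y\<bar> = 0"
    have S_add: "S i (x + y) = S i x + S i y" if "i \<in> Field q" for i
      using uryson_even_add[OF S(1)[OF that] xy] .
    show "H (x + y) = H x + H y"
    proof (rule order.antisym)
      show "H x + H y \<le> H (x + y)"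
        by (rule greatest) (simp add: S_add add_mono lower)
      have "H (x + y) \<le> S i x + S j y" if "i \<in> Field q" "j \<in> Field q" for i j
      proof -
        obtain k where k: "(i, k) \<in> q" "(j, k) \<in> q"
          using directedD(4)[OF q] \<open>i \<in> Field q\<close> \<open>j \<in> Field q\<close> by blast
        then have "k \<in> Field q"
          by (auto simp: Field_def)
        then have "H (x + y) \<le> S k x + S k y"
          using lower[of k "x + y"] S_add by simp
        also have "\<dots> \<le> S i x + S j y"
          using dec k by (intro add_mono) (auto simp: le_fun_def)
        finally show ?thesis .
      qed
      then have "H (x + y) - S j y \<le> H x" if "j \<in> Field q" for j
        using that by (intro greatest) (simp add: algebra_simps)
      then have "H (x + y) - H x \<le> H y"
        by (intro greatest) (simp add: algebra_simps)
      then show "H (x + y) \<le> H x + H y"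
        by (simp add: algebra_simps)
    qed
  next
    show "H (- x) = H x" for x
      unfolding H_def by (rule INF_cong) (simp_all add: uryson_even_minus[OF S(1)])
  next
    fix a :: 'e
    obtain i where i: "i \<in> Field q"
      using ne by blast
    obtain l u where "\<forall>x. \<bar>x\<bar> \<le> a \<longrightarrow> l \<le> S i x \<and> S i x \<le> u"
      using uryson_even_bounded[OF S(1)[OF i]] by blast
    moreover have "0 \<le> H x" for x
      using S(2) by (intro greatest) (auto simp: le_fun_def)
    ultimately show "\<exists>l u. \<forall>x. \<bar>x\<bar> \<le> a \<longrightarrow> l \<le> H x \<and> H x \<le> u"
      using lower[OF i] order_trans by blast
  qed
  moreover have "H = (\<lambda>x. INF i\<in>Field q. S i x)"
    by (simp add: fun_eq_iff H_def)
  ultimately show "(\<lambda>x. INF i\<in>Field q. S i x) \<in> uryson_even"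
    by simp
  show "i \<in> Field q \<Longrightarrow> (INF i\<in>Field q. S i x) \<le> S i x"
    using lower by (simp add: H_def)
  show "(\<And>i. i \<in> Field q \<Longrightarrow> y \<le> S i x) \<Longrightarrow> y \<le> (INF i\<in>Field q. S i x)"
    using greatest by (simp add: H_def)
qed

lemma uryson_even_isGlb_pointwise:
  fixes S :: "'i \<Rightarrow> 'e::{ordered_real_vector, lattice_ab_group_add_abs} \<Rightarrow>
    'f::{ordered_real_vector, conditionally_complete_lattice}"
  assumes "directed q" "\<And>i j. (i, j) \<in> q \<Longrightarrow> S j \<le> S i" "S ` Field q \<subseteq> uryson_even"
    and glb: "isGlb uryson_even (S ` Field q) 0"
    and y: "\<And>i. i \<in> Field q \<Longrightarrow> y \<le> S i x"
  shows "y \<le> 0"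
proof -
  have S: "S i \<in> uryson_even" "0 \<le> S i" if "i \<in> Field q" for i
    using assms(3) glb that by (auto simp: isGlb_iff)
  note inf = decreasing_net_inf_uryson_even[where S = S, OF assms(1,2) S]
  have "(\<lambda>x. INF i\<in>Field q. S i x) \<le> 0"
    using glb inf(1,2) by (auto simp: isGlb_iff le_fun_def)
  then have "(INF i\<in>Field q. S i x) \<le> 0"
    by (simp add: le_fun_def)
  with inf(3)[of y x] y show ?thesis
    using order_trans by blast
qed

lemma directed_nat_le: "directed {(m, n :: nat). m \<le> n}" "Field {(m, n :: nat). m \<le> n} = UNIV"
proof -
  show F: "Field {(m, n :: nat). m \<le> n} = UNIV"
    by (auto simp: Field_def)
  show "directed {(m, n :: nat). m \<le> n}"
    unfolding directed_def F
    by (auto simp: preorder_on_def refl_on_def trans_def intro: max.cobounded1 max.cobounded2)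
qed

lemma band_component_exists:
  fixes h x :: "'f::{ordered_real_vector, conditionally_complete_lattice}"
  assumes "0 \<le> h" "0 \<le> x"
  shows "\<exists>e. band_component h x e"
proof
  show "band_component h x (SUP n. inf (real n *\<^sub>R h) x)"
    by standard (use assms in \<open>auto intro!: cSUP_upper bdd_aboveI[of _ x] cSUP_least\<close>)
qed

text \<open>The supremum of the increasing sequence is \<open>x\<close> minus the pointwise infimum of the decreasing
  positive operators \<open>x - inf (n h) x\<close>.\<close>
lemma band_component_exists_op:
  fixes h x :: "('e::{ordered_real_vector, lattice_ab_group_add_abs},
    'f::{ordered_real_vector, conditionally_complete_lattice}) uryson_op"
  assumes h: "0 \<le> h" and x: "0 \<le> x"
  shows "\<exists>e. band_component h x e"
proof -
  define D where "D n = app (x - inf (real n *\<^sub>R h) x)" for n :: nat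
  have dec: "D n \<le> D m" if "m \<le> n" for m n
  proof -
    have "inf (real m *\<^sub>R h) x \<le> inf (real n *\<^sub>R h) x"
      using h that by (intro inf_mono scaleR_right_mono) auto
    then have "x - inf (real n *\<^sub>R h) x \<le> x - inf (real m *\<^sub>R h) x"
      by (rule diff_left_mono)
    then show ?thesis
      unfolding D_def by (simp add: less_eq_uryson_op.rep_eq)
  qed
  have D: "D n \<in> uryson_even" "0 \<le> D n" for n
  proof -
    have "0 \<le> x - inf (real n *\<^sub>R h) x"
      by simp
    then show "0 \<le> D n"
      unfolding D_def less_eq_uryson_op.rep_eq zero_uryson_op.rep_eq .
  qed (simp add: D_def app)
  note inf =
    decreasing_net_inf_uryson_even[OF directed_nat_le(1), of D, unfolded directed_nat_le(2)]
  define H where "H = Abs_op (\<lambda>x. INF n. D n x)"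
  have app_H: "app H = (\<lambda>x. INF n. D n x)"
    unfolding H_def using inf(1) dec D by (intro Abs_op_inverse) auto
  have lower: "H \<le> x - inf (real n *\<^sub>R h) x" for n
    unfolding less_eq_uryson_op.rep_eq app_H using inf(2) dec D by (auto simp: D_def le_fun_def)
  have greatest: "Y \<le> H" if "\<And>n. Y \<le> x - inf (real n *\<^sub>R h) x" for Y
    unfolding less_eq_uryson_op.rep_eq app_H le_fun_def
    using inf(3) dec D that by (auto simp: D_def less_eq_uryson_op.rep_eq le_fun_def)
  have "band_component h x (x - H)"
  proof
    show "inf (real n *\<^sub>R h) x \<le> x - H" for n
      using lower[of n] by (simp add: algebra_simps)
    show "x - H \<le> y" if "\<And>n. inf (real n *\<^sub>R h) x \<le> y" for y
      using greatest[of "x - y"] that by (simp add: algebra_simps)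
  qed (rule h x)+
  then show ?thesis ..
qed

section \<open>Lattice-normed spaces\<close>

locale lattice_norm =
  fixes nrm :: "'v::real_vector \<Rightarrow> 'e::{ordered_real_vector, lattice}"
  assumes lattice_normed: "lattice_normed_space UNIV UNIV nrm"
begin

lemma norm_nonneg: "0 \<le> nrm v"
  and norm_eq_zero: "nrm v = 0 \<longleftrightarrow> v = 0"
  and norm_triangle: "nrm (v + w) \<le> nrm v + nrm w"
  and norm_scale: "nrm (c *\<^sub>R v) = \<bar>c\<bar> *\<^sub>R nrm v"
  using lattice_normed by (auto simp: lattice_normed_space_def)

lemma archimedean: "(\<And>n. real n *\<^sub>R x \<le> y) \<Longrightarrow> x \<le> (0 :: 'e)"
  using lattice_normed unfolding lattice_normed_space_def archimedean_vector_lattice_def by blast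

lemma norm_zero: "nrm 0 = 0"
  by (simp add: norm_eq_zero)

lemma norm_le_zero: "nrm v \<le> 0 \<Longrightarrow> v = 0"
  using norm_nonneg[of v] norm_eq_zero[of v] by (simp add: order.antisym)

lemma norm_minus: "nrm (- v) = nrm v"
  using norm_scale[of "- 1" v] by simp

lemma norm_diff_commute: "nrm (v - w) = nrm (w - v)"
  using norm_minus[of "v - w"] by simp

lemma norm_triangle_diff: "nrm (v - w) \<le> nrm v + nrm w"
  using norm_triangle[of v "- w"] by (simp add: norm_minus)

lemma norm_dist_triangle: "nrm (x - z) \<le> nrm (x - y) + nrm (y - z)"
  using norm_triangle[of "x - y" "y - z"] by simp

lemma norm_add_disjoint: "inf (nrm u) (nrm v) = 0 \<Longrightarrow> nrm (u + v) = nrm u + nrm v"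
  by (intro subadditive_add_disjoint norm_nonneg norm_minus norm_triangle)

text \<open>The positive part of \<open>y\<close> satisfies the same bounds, and \<open>n \<le> 2 ^ n\<close> reduces the claim to the
  Archimedean property.\<close>
lemma le_geometric_imp_le_zero:
  fixes y s :: 'e
  assumes "0 \<le> s" "\<And>n. y \<le> (1 / 2) ^ n *\<^sub>R s"
  shows "y \<le> 0"
proof -
  have "real n *\<^sub>R sup y 0 \<le> s" for n
  proof -
    have "real n *\<^sub>R sup y 0 \<le> 2 ^ n *\<^sub>R sup y 0"
      by (intro scaleR_right_mono) (use of_nat_less_two_power[of n] in \<open>auto simp: less_imp_le\<close>)
    also have "\<dots> \<le> 2 ^ n *\<^sub>R (1 / 2) ^ n *\<^sub>R s"
      using assms by (intro scaleR_left_mono) (auto simp: scaleR_nonneg_nonneg)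
    also have "\<dots> = s"
      by (simp add: power_one_over)
    finally show ?thesis .
  qed
  then have "sup y 0 \<le> 0"
    by (rule archimedean)
  then show ?thesis
    by simp
qed

end

lemma le_double_imp_half_le:
  fixes y f :: "'e::ordered_real_vector"
  assumes "y \<le> f + f"
  shows "(1 / 2) *\<^sub>R y \<le> f"
  using scaleR_left_mono[OF assms, of "1 / 2"] by (simp flip: scaleR_add_left add: scaleR_add_right)

lemma le_zero_of_le_double:
  fixes f :: "'i \<Rightarrow> 'e::ordered_real_vector"
  assumes inf: "\<And>y. (\<And>i. i \<in> I \<Longrightarrow> y \<le> f i) \<Longrightarrow> y \<le> 0"
    and "\<And>i. i \<in> I \<Longrightarrow> y \<le> f i + f i"
  shows "y \<le> 0"
proof -
  have "(1 / 2) *\<^sub>R y \<le> 0"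
    using assms(2) by (intro inf le_double_imp_half_le)
  from scaleR_left_mono[OF this, of 2] show ?thesis
    by simp
qed

locale decomposable_norm = lattice_norm nrm
  for nrm :: "'v::real_vector \<Rightarrow> 'e::{ordered_real_vector, lattice}" +
  assumes decomposable: "decomposable UNIV UNIV nrm"
begin

lemma decompose:
  assumes "0 \<le> e1" "0 \<le> e2" "nrm x = e1 + e2"
  obtains x1 x2 where "x = x1 + x2" "nrm x1 = e1" "nrm x2 = e2"
  using decomposable assms unfolding decomposable_def by blast

text \<open>Two elements \<open>u\<close>, \<open>u'\<close> that are disjoint to their complements in \<open>v\<close> have a common part \<open>p\<close>. Splitting \<open>u\<close> along \<open>inf (nrm u) (nrm u')\<close> and
  splitting \<open>u'\<close> likewise yields candidates \<open>p\<close> and \<open>p'\<close>. Their difference is also a difference of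
  elements living in the complements of \<open>u\<close> and \<open>u'\<close>, so its norm is disjoint to itself and \<open>p = p'\<close>.\<close>
lemma disjoint_refinement:
  assumes "inf (nrm u) (nrm (v - u)) = 0" "inf (nrm u') (nrm (v - u')) = 0"
  obtains p q r where "u = p + q" "u' = p + r"
    "inf (nrm p) (nrm q) = 0" "inf (nrm p) (nrm r) = 0"
    "fragment (nrm q) (nrm u)" "fragment (nrm q) (nrm (v - u'))"
    "fragment (nrm r) (nrm u')" "fragment (nrm r) (nrm (v - u))"
proof -
  define a a' b b' where "a = nrm u" and "a' = nrm (v - u)" and "b = nrm u'" and "b' = nrm (v - u')"
  have disj: "inf a a' = 0" "inf b b' = 0"
    using assms by (simp_all add: a_def a'_def b_def b'_def)
  have v: "nrm v = a + a'" "nrm v = b + b'"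
    using norm_add_disjoint[OF assms(1)] norm_add_disjoint[OF assms(2)]
    by (simp_all add: a_def a'_def b_def b'_def)
  have "b + b' - a = a'" "a + a' - b = b'"
    using v by (simp_all add: diff_eq_eq add.commute)
  then have "fragment a (b + b')" "fragment b (a + a')"
    using disj by (simp_all add: fragment_def)
  note fa = fragment_split[OF this(1) disj(2)] and fb = fragment_split[OF this(2) disj(1)]
  have nn: "0 \<le> a" "0 \<le> a'" "0 \<le> b" "0 \<le> b'"
    by (simp_all add: a_def a'_def b_def b'_def norm_nonneg)
  obtain p q where pq: "u = p + q" "nrm p = inf a b" "nrm q = inf a b'"
    by (rule decompose[of "inf a b" "inf a b'" u, folded a_def, OF _ _ fa(3)]) (use nn in auto)
  obtain p' r where p'r: "u' = p' + r" "nrm p' = inf b a" "nrm r = inf b a'"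
    by (rule decompose[of "inf b a" "inf b a'" u', folded b_def, OF _ _ fb(3)]) (use nn in auto)
  have "inf (inf a b) a' = 0"
    by (rule disjoint_mono[OF disj(1)]) (use nn in auto)
  moreover have "inf (inf a b) b' = 0"
    by (rule disjoint_mono[OF disj(2)]) (use nn in auto)
  ultimately have "inf (inf a b) (a' + b') = 0"
    by (rule disjoint_add_right)
  then have "inf (inf a b) ((a' + b') + (a' + b')) = 0"
    using disjoint_add_right by blast
  then have "inf (inf a b + inf a b) ((a' + b') + (a' + b')) = 0"
    using disjoint_add by blast
  moreover have "nrm (p - p') \<le> inf a b + inf a b"
    using norm_triangle_diff[of p p'] pq p'r by (simp add: inf.commute)
  moreover have "nrm (p - p') \<le> (a' + b') + (a' + b')"
  proof -
    have "p - p' = (r + (v - u')) - (q + (v - u))"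
      using pq p'r by simp
    then have "nrm (p - p') \<le> (nrm r + b') + (nrm q + a')"
      unfolding a'_def b'_def by (metis add_mono norm_triangle norm_triangle_diff order_trans)
    also have "\<dots> \<le> (a' + b') + (b' + a')"
      using pq p'r by (intro add_mono) auto
    finally show ?thesis
      by (simp add: algebra_simps)
  qed
  ultimately have "nrm (p - p') \<le> 0"
    by (rule disjoint_self)
  then have "p = p'"
    using norm_le_zero[of "p - p'"] by simp
  have "fragment (nrm q) a"
    using fa(3,4) pq unfolding fragment_def by (metis add_diff_cancel_right' inf.commute)
  moreover have "fragment (nrm r) b"
    using fb(3,4) p'r unfolding fragment_def by (metis add_diff_cancel_right' inf.commute)
  ultimately show ?thesis
    using that[of p q r] pq p'r \<open>p = p'\<close> fa(2,4) fb(2,4)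
    by (simp add: a_def a'_def b_def b'_def inf.commute)
qed

end

section \<open>Common centres in Banach-Kantorovich spaces\<close>

locale bk_norm = decomposable_norm nrm
  for nrm :: "'w::real_vector \<Rightarrow> 'f::{ordered_real_vector, conditionally_complete_lattice}" +
  assumes complete: "bo_complete TYPE('w \<times> 'w set) UNIV UNIV nrm"
begin

context
  fixes I :: "'i set" and w :: "'i \<Rightarrow> 'w" and f :: "'i \<Rightarrow> 'f"
  assumes ne: "I \<noteq> {}"
    and dist: "\<And>i j. i \<in> I \<Longrightarrow> j \<in> I \<Longrightarrow> nrm (w i - w j) \<le> f i + f j"
    and inf_zero: "\<And>y. (\<And>i. i \<in> I \<Longrightarrow> y \<le> f i) \<Longrightarrow> y \<le> 0"
begin

text \<open>A pair \<open>(x, g)\<close> says that \<open>x\<close> misses every \<open>w i\<close> by at most \<open>g\<close> more than the radius allows. A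
  common centre is an approximant with \<open>g = 0\<close>.\<close>
definition approximants :: "('w \<times> 'f) set"
  where "approximants = {(x, g). \<forall>i\<in>I. nrm (x - w i) \<le> g + f i}"

lemma approximant_radius_nonneg: "(x, g) \<in> approximants \<Longrightarrow> 0 \<le> g"
proof -
  assume "(x, g) \<in> approximants"
  then have "0 \<le> g + f i" if "i \<in> I" for i
    using that norm_nonneg[of "x - w i"] order_trans unfolding approximants_def by blast
  then have "- g \<le> f i" if "i \<in> I" for i
    using that by (simp add: minus_le_iff add.commute flip: le_diff_eq diff_le_eq)
  then have "- g \<le> 0"
    by (rule inf_zero)
  then show "0 \<le> g"
    by simp
qed

text \<open>Comparing both approximants with the same \<open>w i\<close> adds \<open>f i + f i\<close>, which has infimum \<open>0\<close>.\<close>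
lemma approximants_close:
  assumes "(x, g) \<in> approximants" "(y, h) \<in> approximants"
  shows "nrm (x - y) \<le> g + h"
proof -
  have "nrm (x - y) - (g + h) \<le> f i + f i" if "i \<in> I" for i
  proof -
    have "nrm (x - y) \<le> nrm (x - w i) + nrm (y - w i)"
      using norm_dist_triangle[of x y "w i"] by (simp add: norm_diff_commute[of "w i"])
    also have "\<dots> \<le> (g + f i) + (h + f i)"
      using assms that by (intro add_mono) (auto simp: approximants_def)
    finally show ?thesis
      by (simp add: algebra_simps)
  qed
  with inf_zero have "nrm (x - y) - (g + h) \<le> 0"
    by (rule le_zero_of_le_double)
  then show ?thesis
    by simp
qed

text \<open>Take \<open>x\<close> where \<open>g \<le> h\<close> and \<open>y\<close> where \<open>h \<le> g\<close>. Formally, split \<open>y - x = u + u'\<close> so that the norm of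
  \<open>u\<close> is the component of \<open>nrm (y - x)\<close> in the band of \<open>k = (g - h)\<^sup>+\<close>, and take
  \<open>x + u = y - u'\<close>. Compared with \<open>x\<close>, its excess over the radius \<open>inf g h + f i\<close> is at most \<open>k + nrm u\<close>,
  in the band of \<open>k\<close>; compared with \<open>y\<close>, it is at most \<open>(h - g)\<^sup>+ + nrm u'\<close>, disjoint to that band.\<close>
lemma approximants_mix:
  assumes xg: "(x, g) \<in> approximants" and yh: "(y, h) \<in> approximants"
  obtains z where "(z, inf g h) \<in> approximants"
proof -
  define k l where "k = g - inf g h" and "l = h - inf g h"
  have k: "0 \<le> k" and kl: "inf k l = 0"
    using pos_neg_parts_disjoint[of "g - h"]
      diff_inf_eq_pos_part[of g h] diff_inf_eq_pos_part[of h g]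
    by (simp_all add: k_def l_def inf.commute[of h])
  obtain e where e: "band_component k (nrm (y - x)) e"
    using band_component_exists[OF k norm_nonneg] by blast
  then interpret band_component k "nrm (y - x)" e .
  obtain u u' where u: "y - x = u + u'" "nrm u = e" "nrm u' = nrm (y - x) - e"
    using decompose[of e "nrm (y - x) - e" "y - x"] nonneg le by auto
  have "nrm (x + u - w i) \<le> inf g h + f i" if i: "i \<in> I" for i
  proof -
    define m where "m = inf g h + f i"
    have "nrm (x + u - w i) \<le> nrm (x - w i) + nrm u"
      using norm_triangle[of "x - w i" u] by (simp add: algebra_simps)
    also have "\<dots> \<le> g + f i + e"
      using xg i u by (auto simp: approximants_def)
    finally have le1: "nrm (x + u - w i) - m \<le> k + e"
      by (simp add: k_def m_def algebra_simps)
    have "x + u - w i = (y - w i) - u'"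
      using u(1) by (simp add: algebra_simps)
    then have "nrm (x + u - w i) \<le> nrm (y - w i) + nrm u'"
      using norm_triangle_diff[of "y - w i" u'] by metis
    also have "\<dots> \<le> h + f i + (nrm (y - x) - e)"
      using yh i u by (auto simp: approximants_def)
    finally have le2: "nrm (x + u - w i) - m \<le> l + (nrm (y - x) - e)"
      by (simp add: l_def m_def algebra_simps)
    have "inf (l + (nrm (y - x) - e)) k = 0"
      using kl disjoint_rest by (intro disjoint_add) (simp_all add: inf.commute)
    then have "inf (l + (nrm (y - x) - e)) (k + e) = 0"
      by (intro disjoint_add_right disjoint_component)
    then show ?thesis
      using le_of_diff_bounded_by_disjoint[OF _ le2 le1] by (simp add: m_def)
  qed
  then show ?thesis
    by (intro that[of "x + u"]) (simp add: approximants_def)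
qed

text \<open>The approximants form a net indexed by themselves, directed by decreasing \<open>g\<close>.\<close>
definition refines :: "('w \<times> 'f) rel"
  where "refines = {((x, g), (y, h)). (x, g) \<in> approximants \<and> (y, h) \<in> approximants \<and> h \<le> g}"

lemma Field_refines: "Field refines = approximants"
  unfolding refines_def Field_def by auto

lemma centre_approximant: "i \<in> I \<Longrightarrow> (w i, f i) \<in> approximants"
  using dist by (auto simp: approximants_def)

lemma directed_refines: "directed refines"
  unfolding directed_def Field_refines
proof (intro conjI ballI)
  show "preorder_on approximants refines"
    by (auto simp: preorder_on_def refl_on_def trans_def refines_def)
  show "approximants \<noteq> {}"
    using ne centre_approximant by auto
  fix a b assume "a \<in> approximants" "b \<in> approximants"
  moreover obtain x g y h where ab: "a = (x, g)" "b = (y, h)"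
    by (metis surj_pair)
  moreover obtain z where "(z, inf g h) \<in> approximants"
    using calculation approximants_mix by blast
  ultimately show "\<exists>c. (a, c) \<in> refines \<and> (b, c) \<in> refines"
    by (intro exI[of _ "(z, inf g h)"]) (simp add: refines_def)
qed

lemma bo_fundamental_refines: "bo_fundamental UNIV nrm refines fst"
  unfolding bo_fundamental_def
proof (rule bo_convergesI)
  show "regulates UNIV nrm (prod_rel refines refines) (\<lambda>(a, b). fst a - fst b) 0
    refines (\<lambda>a. snd a + snd a)"
    unfolding regulates_def Field_refines isGlb_iff
  proof (intro conjI ballI allI impI)
    fix y assume "\<forall>a\<in>(\<lambda>a. snd a + snd a) ` approximants. y \<le> a"
    then show "y \<le> 0"
      using centre_approximant by (intro le_zero_of_le_double[OF inf_zero]) force+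
  next
    fix a assume a: "a \<in> approximants"
    show "\<exists>p\<in>Field (prod_rel refines refines). \<forall>b. (p, b) \<in> prod_rel refines refines \<longrightarrow>
      nrm (0 - (case b of (a, b) \<Rightarrow> fst a - fst b)) \<le> snd a + snd a"
    proof (intro bexI[of _ "(a, a)"] allI impI)
      show "(a, a) \<in> Field (prod_rel refines refines)"
        using directedD(2)[OF directed_refines, of a] a
        by (intro FieldI1[of _ "(a, a)"]) (simp add: Field_refines prod_rel_def)
      fix b assume "((a, a), b) \<in> prod_rel refines refines"
      then obtain x g y h where b: "b = ((x, g), (y, h))" and
        xy: "(x, g) \<in> approximants" "(y, h) \<in> approximants" "g \<le> snd a" "h \<le> snd a"
        by (auto simp: prod_rel_def refines_def)
      have "nrm (y - x) \<le> h + g"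
        by (rule approximants_close) (rule xy)+
      also have "\<dots> \<le> snd a + snd a"
        using xy by (intro add_mono)
      finally show "nrm (0 - (case b of (a, b) \<Rightarrow> fst a - fst b)) \<le> snd a + snd a"
        by (simp add: b)
    qed
  qed (use directed_refines in \<open>auto simp: refines_def approximant_radius_nonneg add_mono\<close>)
qed

text \<open>The (bo)-limit of the net of approximants is a centre: every \<open>(w j, f j)\<close> is an approximant, so
  far along the net \<open>g\<close> is below each \<open>f j\<close>, and the \<open>f j\<close> have infimum \<open>0\<close>.\<close>
theorem centre_exists: "\<exists>x. \<forall>i\<in>I. nrm (x - w i) \<le> f i"
proof -
  obtain x where "bo_converges UNIV nrm refines fst x"
    using bo_complete_all_types[OF complete] directed_refines bo_fundamental_refines
    unfolding bo_complete_def by blast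
  then obtain q :: "'f rel" and e where q: "regulates UNIV nrm refines fst x q e"
    unfolding bo_converges_def by blast
  have "nrm (x - w i) \<le> f i" if i: "i \<in> I" for i
  proof -
    have le: "nrm (x - w i) - f i \<le> e \<gamma> + f j" if \<gamma>: "\<gamma> \<in> Field q" and j: "j \<in> I" for \<gamma> j
    proof -
      obtain a where a: "a \<in> approximants" "\<And>b. (a, b) \<in> refines \<Longrightarrow> nrm (x - fst b) \<le> e \<gamma>"
        using q \<gamma> unfolding regulates_def Field_refines by blast
      obtain b where b: "(a, b) \<in> refines" "((w j, f j), b) \<in> refines"
        using directedD(4)[OF directed_refines] a(1) centre_approximant[OF j]
        unfolding Field_refines by blast
      obtain y h where yh: "b = (y, h)" "(y, h) \<in> approximants" "h \<le> f j"
        using b(2) by (auto simp: refines_def)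
      have "nrm (x - w i) \<le> nrm (x - y) + nrm (y - w i)"
        by (rule norm_dist_triangle)
      also have "\<dots> \<le> e \<gamma> + (h + f i)"
        using a(2)[OF b(1)] yh i by (intro add_mono) (auto simp: approximants_def)
      also have "\<dots> \<le> e \<gamma> + (f j + f i)"
        using yh by simp
      finally show ?thesis
        by (simp add: algebra_simps)
    qed
    have "nrm (x - w i) - f i - f j \<le> 0" if j: "j \<in> I" for j
    proof -
      have "nrm (x - w i) - f i - f j \<le> e \<gamma>" if "\<gamma> \<in> Field q" for \<gamma>
        using le[OF that j] by (simp add: algebra_simps)
      moreover have "isGlb UNIV (e ` Field q) 0"
        using q by (simp add: regulates_def)
      ultimately show ?thesis
        unfolding isGlb_iff by (metis UNIV_I imageE)
    qed
    then have "nrm (x - w i) - f i \<le> f j" if "j \<in> I" for j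
      using that by (metis diff_le_0_iff_le)
    then have "nrm (x - w i) - f i \<le> 0"
      by (rule inf_zero)
    then show ?thesis
      by simp
  qed
  then show ?thesis
    by blast
qed

end

end

section \<open>The exact dominant as a supremum of disjoint sums\<close>

text \<open>\<open>disjoint_sum nV nW T c s\<close> says that \<open>c = \<Sum> nV v\<^sub>i\<close> and \<open>s = \<Sum> nW (T v\<^sub>i)\<close> for some finite family with
  pairwise disjoint norms \<open>nV v\<^sub>i\<close>. Carrying \<open>c\<close> along lets disjointness be required only of the newly added
  element.\<close>
inductive disjoint_sum :: "('v::real_vector \<Rightarrow> 'e::{ordered_real_vector, lattice_ab_group_add_abs}) \<Rightarrow>
    ('w::real_vector \<Rightarrow> 'f::{ordered_real_vector, lattice}) \<Rightarrow> ('v \<Rightarrow> 'w) \<Rightarrow> 'e \<Rightarrow> 'f \<Rightarrow> bool"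
  for nV nW T where
  empty: "disjoint_sum nV nW T 0 0"
| insert: "disjoint_sum nV nW T a s \<Longrightarrow> inf a (nV v) = 0 \<Longrightarrow>
    disjoint_sum nV nW T (a + nV v) (s + nW (T v))"

locale norm_pair = V: decomposable_norm nV + W: lattice_norm nW
  for nV :: "'v::real_vector \<Rightarrow> 'e::{ordered_real_vector, lattice_ab_group_add_abs}"
    and nW :: "'w::real_vector \<Rightarrow> 'f::{ordered_real_vector, conditionally_complete_lattice}"
begin

definition orthogonally_additive :: "('v \<Rightarrow> 'w) \<Rightarrow> bool"
  where "orthogonally_additive T \<longleftrightarrow> (\<forall>u v. inf (nV u) (nV v) = 0 \<longrightarrow> T (u + v) = T u + T v)"

lemma orthogonally_additiveD:
  "orthogonally_additive T \<Longrightarrow> inf (nV u) (nV v) = 0 \<Longrightarrow> T (u + v) = T u + T v"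
  by (simp add: orthogonally_additive_def)

lemma dominated_iff:
  "T \<in> dominated_uryson nV nW \<longleftrightarrow> orthogonally_additive T \<and> (\<exists>S. dominant nV nW T S)"
  by (simp add: dominated_uryson_def orthogonally_additive_def)

lemma disjoint_sum_nonneg: "disjoint_sum nV nW T a s \<Longrightarrow> 0 \<le> a"
  by (induction rule: disjoint_sum.induct) (simp_all add: V.norm_nonneg)

lemma disjoint_sum_add:
  assumes "disjoint_sum nV nW T a s" "disjoint_sum nV nW T b t" "inf a b = 0"
  shows "disjoint_sum nV nW T (a + b) (s + t)"
  using assms(1,3)
proof (induction rule: disjoint_sum.induct)
  case empty
  with assms(2) show ?case by simp
next
  case (insert a s v)
  have nn: "0 \<le> a" "0 \<le> b" "0 \<le> nV v"
    using insert assms(2) disjoint_sum_nonneg V.norm_nonneg by auto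
  have "inf a b = 0" "inf (nV v) b = 0"
    by (rule disjoint_mono[OF insert.prems]; use nn in simp)+
  then have "disjoint_sum nV nW T ((a + b) + nV v) ((s + t) + nW (T v))"
    using insert by (intro disjoint_sum.insert insert.IH disjoint_add) (simp_all add: inf.commute)
  then show ?case
    by (simp add: algebra_simps)
qed

text \<open>Every member of the family is cut, by decomposability, into one piece below \<open>a\<close> and one below \<open>b\<close>.
  The pieces are disjoint, so \<open>T\<close> is additive on them and the triangle inequality in \<open>W\<close> can only
  increase the sum.\<close>
lemma disjoint_sum_split:
  assumes T: "orthogonally_additive T"
    and "disjoint_sum nV nW T c s" "c = a + b" "inf a b = 0"
  shows "\<exists>t u. disjoint_sum nV nW T a t \<and> disjoint_sum nV nW T b u \<and> s \<le> t + u"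
  using assms(2-)
proof (induction arbitrary: a b rule: disjoint_sum.induct)
  case empty
  then have "a = 0" "b = 0"
    using disjoint_nonneg[of a b] by (simp_all add: add_nonneg_eq_0_iff eq_commute[of 0])
  then show ?case
    using disjoint_sum.empty by fastforce
next
  case (insert c s v)
  note ab = disjoint_nonneg[OF insert.prems(2)]
  have c: "0 \<le> c"
    using insert disjoint_sum_nonneg by blast
  have v: "0 \<le> nV v"
    by (rule V.norm_nonneg)
  have part: "inf (a + b) x = inf x a + inf x b" if "0 \<le> x" for x
    using inf_add_of_disjoint[OF insert.prems(2) that] by (simp add: inf.commute)
  have c_eq: "c = inf c a + inf c b"
    using part[OF c] insert.prems(1) v by (metis inf.absorb2 le_add_same_cancel1)
  have v_eq: "nV v = inf (nV v) a + inf (nV v) b"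
    using part[OF v] insert.prems(1) c by (metis inf.absorb2 le_add_same_cancel2)
  have disj_part: "inf (inf x a) (inf x b) = 0" if "0 \<le> x" for x
    using ab that by (intro disjoint_mono[OF insert.prems(2)]) auto
  have disj_cv: "inf (inf c x) (inf (nV v) x) = 0" if "0 \<le> x" for x
    using c v that by (intro disjoint_mono[OF insert.hyps(2)]) auto
  obtain t u where tu: "disjoint_sum nV nW T (inf c a) t" "disjoint_sum nV nW T (inf c b) u"
    "s \<le> t + u"
    using insert.IH[OF c_eq disj_part[OF c]] by blast
  obtain v1 v2 where v12: "v = v1 + v2" "nV v1 = inf (nV v) a" "nV v2 = inf (nV v) b"
    using V.decompose[of "inf (nV v) a" "inf (nV v) b" v] v_eq ab v by auto
  have "T v = T v1 + T v2"
    using T disj_part[OF v] v12 by (simp add: orthogonally_additiveD)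
  then have "nW (T v) \<le> nW (T v1) + nW (T v2)"
    using W.norm_triangle by simp
  with tu(3) have "s + nW (T v) \<le> (t + nW (T v1)) + (u + nW (T v2))"
    using add_mono by (fastforce simp: algebra_simps)
  moreover have "inf c x + inf (nV v) x = x" if "0 \<le> x" "x \<le> a + b" for x
    using inf_add_of_disjoint[OF insert.hyps(2) that(1)] insert.prems(1) that(2)
    by (simp add: inf.absorb2)
  then have "inf c a + nV v1 = a" "inf c b + nV v2 = b"
    using ab v12 by simp_all
  moreover have "disjoint_sum nV nW T (inf c a + nV v1) (t + nW (T v1))"
    "disjoint_sum nV nW T (inf c b + nV v2) (u + nW (T v2))"
    using disjoint_sum.insert[OF tu(1), of v1] disjoint_sum.insert[OF tu(2), of v2]
      disj_cv[OF ab(1)] disj_cv[OF ab(2)] v12(2,3) by metis+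
  ultimately show ?case
    by metis
qed

lemma disjoint_sum_le:
  assumes S: "dominant nV nW T S" and "disjoint_sum nV nW T c s"
  shows "s \<le> S c"
proof -
  have U: "S \<in> uryson_even"
    using S by (simp add: dominant_def)
  from assms(2) show ?thesis
    using S by induction
      (auto simp: uryson_even_zero[OF U] uryson_even_add_pos[OF U] dominant_def add_mono)
qed

text \<open>By induction each disjoint sum is bounded by the value of any dominant; this yields both the
  boundedness needed for the supremum and its leastness.\<close>
lemma exact_dominant:
  assumes T: "T \<in> dominated_uryson nV nW"
  shows "dominant nV nW T (exact_dominant nV nW T)"
    and "dominant nV nW T S \<Longrightarrow> exact_dominant nV nW T \<le> S"
proof -
  define G where "G = {(c, s). disjoint_sum nV nW T c s}"
  have orth: "orthogonally_additive T"
    using T by (simp add: dominated_iff)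
  obtain S0 where S0: "dominant nV nW T S0"
    using T by (auto simp: dominated_iff)
  interpret additive_relation G
  proof
    show "(0, 0) \<in> G"
      by (simp add: G_def disjoint_sum.empty)
    show "(a + b, s + t) \<in> G" if "(a, s) \<in> G" "(b, t) \<in> G" "inf a b = 0" for a b s t
      using that by (simp add: G_def disjoint_sum_add)
    show "\<exists>t u. (a, t) \<in> G \<and> (b, u) \<in> G \<and> s \<le> t + u" if "(a + b, s) \<in> G" "inf a b = 0" for a b s
      using disjoint_sum_split[OF orth _ refl that(2)] that(1) by (simp add: G_def)
    fix a
    have "S0 \<in> uryson_even"
      using S0 by (simp add: dominant_def)
    then obtain l u where "\<forall>x. \<bar>x\<bar> \<le> a \<longrightarrow> l \<le> S0 x \<and> S0 x \<le> u"
      using uryson_even_bounded by blast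
    then show "\<exists>u. \<forall>c s. 0 \<le> c \<longrightarrow> c \<le> a \<longrightarrow> (c, s) \<in> G \<longrightarrow> s \<le> u"
      unfolding G_def
      by (metis (no_types, lifting) abs_of_nonneg case_prodD disjoint_sum_le[OF S0]
          mem_Collect_eq order_trans)
  qed
  have dom: "dominant nV nW T (fragment_sup G)"
    unfolding dominant_def
  proof (intro conjI allI sup_uryson_even sup_nonneg)
    fix v
    have "(nV v, nW (T v)) \<in> G"
      using disjoint_sum.insert[OF disjoint_sum.empty, of nV v nW T] V.norm_nonneg[of v]
      by (simp add: G_def inf.absorb1)
    then show "nW (T v) \<le> fragment_sup G (nV v)"
      by (intro sup_upper[OF fragment_self]) (simp_all add: V.norm_nonneg)
  qed
  have least: "fragment_sup G \<le> S" if S: "dominant nV nW T S" for S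
  proof (rule le_funI, rule sup_least)
    fix e c s assume "fragment c \<bar>e\<bar>" "(c, s) \<in> G"
    then have "s \<le> S c" "S c \<le> S \<bar>e\<bar>"
      using S disjoint_sum_le[OF S]
      by (auto simp: G_def dominant_def intro: uryson_even_fragment_mono)
    then show "s \<le> S e"
      using S by (simp add: uryson_even_abs dominant_def)
  qed
  have "exact_dominant nV nW T = fragment_sup G"
    unfolding exact_dominant_def by (rule Least_equality) (fact dom, fact least)
  with dom least show "dominant nV nW T (exact_dominant nV nW T)"
    "dominant nV nW T S \<Longrightarrow> exact_dominant nV nW T \<le> S"
    by simp_all
qed

end

context norm_pair
begin

lemma app_norm_add:
  "inf (nV u) (nV v) = 0 \<Longrightarrow> app S (nV (u + v)) = app S (nV u) + app S (nV v)"
  by (simp add: V.norm_add_disjoint uryson_even_add_pos[OF app])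

lemma orthogonally_additive_combine:
  assumes "orthogonally_additive T" "orthogonally_additive T'"
  shows "orthogonally_additive (\<lambda>v. c *\<^sub>R T v + d *\<^sub>R T' v)"
  using assms by (simp add: orthogonally_additive_def algebra_simps)

end

locale bk_pair = norm_pair nV nW + W: bk_norm nW
  for nV :: "'v::real_vector \<Rightarrow> 'e::{ordered_real_vector, lattice_ab_group_add_abs}"
    and nW :: "'w::real_vector \<Rightarrow> 'f::{ordered_real_vector, conditionally_complete_lattice}"
begin

section \<open>Splitting an operator along a sum of dominants\<close>

text \<open>An element \<open>u\<close> with \<open>u\<close> and \<open>v - u\<close> disjoint is called a fragment of \<open>v\<close>.
  The value of \<open>T'\<close> at \<open>v\<close> should be \<open>T\<close> of the part of \<open>v\<close> seen by \<open>R\<close>. Such a part exists only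
  approximately: a fragment \<open>u\<close> of \<open>v\<close> has the defect \<open>f v u\<close>, the amount of \<open>R\<close> that \<open>u\<close> misses plus the
  amount of \<open>Q\<close> that it contains, and disjointness of \<open>R\<close> and \<open>Q\<close> means that these defects have infimum
  \<open>0\<close>. Two fragments differ only by pieces that count as defects, so the values \<open>T u\<close> have a common
  centre; \<open>T'\<close> inherits additivity and the two bounds from \<open>T\<close> up to defects.\<close>
lemma split_disjoint:
  assumes T: "orthogonally_additive T"
    and R: "0 \<le> R" and Q: "0 \<le> Q" and RQ: "inf R Q = 0"
    and bound: "\<And>v. nW (T v) \<le> app R (nV v) + app Q (nV v)"
  shows "\<exists>T'. orthogonally_additive T' \<and> (\<forall>v. nW (T' v) \<le> app R (nV v)) \<and>
    (\<forall>v. nW (T v - T' v) \<le> app Q (nV v))"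
proof -
  define F where "F v = {u. inf (nV u) (nV (v - u)) = 0}" for v
  define f where "f v u = app R (nV (v - u)) + app Q (nV u)" for v u
  have F_sum: "app S (nV v) = app S (nV u) + app S (nV (v - u))" if "u \<in> F v"
    for S :: "('e, 'f) uryson_op" and u v
    using app_norm_add[of u "v - u" S] that by (simp add: F_def)
  have F_fragment: "fragment (nV u) (nV v)" "nV (v - u) = nV v - nV u" if "u \<in> F v" for u v
    using V.norm_add_disjoint[of u "v - u"] that by (simp_all add: F_def fragment_def)
  have inf_f: "y \<le> 0" if y: "\<And>u. u \<in> F v \<Longrightarrow> y \<le> f v u" for v y
  proof (rule disjoint_op_inf_zero[OF RQ])
    fix c assume c: "fragment c \<bar>nV v\<bar>"
    obtain u u' where u: "v = u + u'" "nV u = c" "nV u' = nV v - c"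
      using fragment_bounds[OF c]
      by (elim V.decompose[of c "nV v - c" v, rotated 3]) (simp_all add: V.norm_nonneg)
    then have "u \<in> F v"
      using c by (simp add: F_def fragment_def V.norm_nonneg)
    then show "y \<le> app R (\<bar>nV v\<bar> - c) + app Q c"
      using y[of u] u by (simp add: f_def V.norm_nonneg)
  qed
  have close: "nW (T u - T u') \<le> f v u + f v u'" if u: "u \<in> F v" "u' \<in> F v" for u u' v
  proof -
    obtain p q r where pqr: "u = p + q" "u' = p + r"
      "inf (nV p) (nV q) = 0" "inf (nV p) (nV r) = 0"
      "fragment (nV q) (nV u)" "fragment (nV q) (nV (v - u'))"
      "fragment (nV r) (nV u')" "fragment (nV r) (nV (v - u))"
      using V.disjoint_refinement u unfolding F_def by blast
    have "T u - T u' = T q - T r"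
      using pqr(1-4) T by (simp add: orthogonally_additiveD)
    then have "nW (T u - T u') \<le> nW (T q) + nW (T r)"
      by (simp add: W.norm_triangle_diff)
    also have "\<dots> \<le> (app R (nV q) + app Q (nV q)) + (app R (nV r) + app Q (nV r))"
      by (intro add_mono bound)
    also have "\<dots> \<le> (app R (nV (v - u')) + app Q (nV u)) + (app R (nV (v - u)) + app Q (nV u'))"
      using pqr(5-8) R Q by (intro add_mono app_fragment_mono)
    finally show ?thesis
      by (simp add: f_def algebra_simps)
  qed
  have "\<exists>x. \<forall>u\<in>F v. nW (x - T u) \<le> f v u" for v
  proof (rule W.centre_exists)
    have "0 \<in> F v"
      by (simp add: F_def V.norm_zero V.norm_nonneg inf.absorb1)
    then show "F v \<noteq> {}"
      by blast
  qed (use close inf_f in blast)+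
  then obtain T' where T': "\<And>v u. u \<in> F v \<Longrightarrow> nW (T' v - T u) \<le> f v u"
    by metis
  have "orthogonally_additive T'"
    unfolding orthogonally_additive_def
  proof (intro allI impI)
    fix x y assume xy: "inf (nV x) (nV y) = 0"
    \<comment> \<open>Both sides lie within \<open>f x a + f y b\<close> of \<open>T (a + b)\<close>. The two infima are taken one after the
      other, which needs half the distance on the left.\<close>
    define h where "h = (1 / 2) *\<^sub>R nW (T' (x + y) - (T' x + T' y))"
    have h: "h \<le> f x a + f y b" if a: "a \<in> F x" and b: "b \<in> F y" for a b
    proof -
      note fr = fragment_add[OF F_fragment(1)[OF a] F_fragment(1)[OF b] xy]
      have ab': "inf (nV (x - a)) (nV (y - b)) = 0"
        using fragment_add(1)[OF fragment_diff fragment_diff xy] F_fragment[OF a] F_fragment[OF b]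
        by simp
      have diff: "x + y - (a + b) = (x - a) + (y - b)"
        by simp
      have "nV (x + y - (a + b)) = nV x + nV y - (nV a + nV b)"
        unfolding diff V.norm_add_disjoint[OF ab'] F_fragment(2)[OF a] F_fragment(2)[OF b] by simp
      then have "a + b \<in> F (x + y)"
        using fr(2) V.norm_add_disjoint[OF fr(1)] by (simp only: F_def mem_Collect_eq fragment_def)
      then have "nW (T' (x + y) - T (a + b)) \<le> f (x + y) (a + b)"
        by (rule T')
      also have "f (x + y) (a + b) = f x a + f y b"
        unfolding f_def diff app_norm_add[OF fr(1)] app_norm_add[OF ab'] by (simp only: ac_simps)
      finally have 1: "nW (T' (x + y) - T (a + b)) \<le> f x a + f y b" .
      have "T' (x + y) - (T' x + T' y) = (T' (x + y) - T (a + b)) - ((T' x - T a) + (T' y - T b))"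
        using orthogonally_additiveD[OF T fr(1)] by simp
      then have "nW (T' (x + y) - (T' x + T' y)) \<le>
          nW (T' (x + y) - T (a + b)) + nW ((T' x - T a) + (T' y - T b))"
        by (simp only: W.norm_triangle_diff)
      also have "\<dots> \<le> (f x a + f y b) + (nW (T' x - T a) + nW (T' y - T b))"
        by (intro add_mono 1 W.norm_triangle)
      also have "\<dots> \<le> (f x a + f y b) + (f x a + f y b)"
        using a b by (intro add_left_mono add_mono T')
      finally show ?thesis
        unfolding h_def by (rule le_double_imp_half_le)
    qed
    have "h - f y b \<le> 0" if "b \<in> F y" for b
      using h that by (intro inf_f[of x]) (simp add: diff_le_eq)
    then have "h \<le> 0"
      by (intro inf_f[of y]) simp
    then have "nW (T' (x + y) - (T' x + T' y)) \<le> 0"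
      using scaleR_left_mono[of h 0 2] by (simp add: h_def)
    then show "T' (x + y) = T' x + T' y"
      using W.norm_le_zero by fastforce
  qed
  moreover have "nW (T' v) \<le> app R (nV v)" for v
  proof -
    have "nW (T' v) - app R (nV v) \<le> f v u + f v u" if u: "u \<in> F v" for u
    proof -
      have "nW (T' v) \<le> nW (T' v - T u) + nW (T u)"
        using W.norm_triangle[of "T' v - T u" "T u"] by simp
      also have "\<dots> \<le> f v u + (app R (nV u) + app Q (nV u))"
        by (intro add_mono T' u bound)
      also have "\<dots> \<le> f v u + (app R (nV v) + f v u)"
        using app_fragment_mono[OF R F_fragment(1)[OF u]] app_nonneg[OF R]
        by (intro add_left_mono add_mono) (simp_all add: f_def)
      finally show ?thesis
        by (simp add: diff_le_eq ac_simps)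
    qed
    then show ?thesis
      using le_zero_of_le_double[of "F v" "f v"] inf_f[of v] by fastforce
  qed
  moreover have "nW (T v - T' v) \<le> app Q (nV v)" for v
  proof -
    have "nW (T v - T' v) - app Q (nV v) \<le> f v u + f v u" if u: "u \<in> F v" for u
    proof -
      have "T v = T u + T (v - u)"
        using orthogonally_additiveD[OF T, of u "v - u"] u by (simp add: F_def)
      then have "nW (T v - T' v) \<le> nW (T' v - T u) + nW (T (v - u))"
        using W.norm_triangle_diff[of "T (v - u)" "T' v - T u"] by (simp add: algebra_simps)
      also have "\<dots> \<le> f v u + (app R (nV (v - u)) + app Q (nV (v - u)))"
        by (intro add_mono T' u bound)
      also have "\<dots> \<le> f v u + (f v u + app Q (nV v))"
        using F_sum[OF u, of Q] app_nonneg[OF Q]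
        by (intro add_left_mono add_mono) (simp_all add: f_def)
      finally show ?thesis
        by (simp add: diff_le_eq ac_simps)
    qed
    then show ?thesis
      using le_zero_of_le_double[of "F v" "f v"] inf_f[of v] by fastforce
  qed
  ultimately show ?thesis
    by blast
qed

text \<open>\<open>P\<close> and \<open>Q\<close> are what is left of \<open>S1\<close> and \<open>S2\<close> after half of the disjoint splitting along the band of
  \<open>(S1 - S2)\<^sup>+\<close> has been used up; they are nonnegative because that splitting exceeds \<open>S1\<close> and \<open>S2\<close> at
  most by a factor of two. Their sum dominates the half of \<open>T\<close> that is still to be distributed.\<close>
lemma split_half:
  assumes T: "orthogonally_additive T"
    and S: "0 \<le> S1" "0 \<le> S2"
    and bound: "\<And>v. nW (T v) \<le> app (S1 + S2) (nV v)"
  shows "\<exists>A P Q. orthogonally_additive A \<and> 0 \<le> P \<and> 0 \<le> Q \<and> P + Q = (1 / 2) *\<^sub>R (S1 + S2) \<and>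
    (\<forall>v. nW (A v) \<le> app (S1 - P) (nV v)) \<and>
    (\<forall>v. nW ((1 / 2) *\<^sub>R T v - A v) \<le> app (S2 - Q) (nV v))"
proof -
  obtain e where e: "band_component (sup (S1 - S2) 0) (S1 + S2) e"
    using band_component_exists_op[of "sup (S1 - S2) 0" "S1 + S2"] S by auto
  then interpret band_component "sup (S1 - S2) 0" "S1 + S2" e .
  note b = band_component_bounds[OF e S]
  have sum: "app (S1 + S2) x = app e x + app (S1 + S2 - e) x" for x
    by (simp add: plus_uryson_op.rep_eq minus_uryson_op.rep_eq)
  obtain T' where T': "orthogonally_additive T'" "\<And>v. nW (T' v) \<le> app e (nV v)"
    "\<And>v. nW (T v - T' v) \<le> app (S1 + S2 - e) (nV v)"
    using split_disjoint[OF T nonneg _ b(1)] le bound sum by auto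
  define A P Q where "A = (\<lambda>v. (1 / 2) *\<^sub>R T' v)" and "P = S1 - (1 / 2) *\<^sub>R e"
    and "Q = S2 - (1 / 2) *\<^sub>R (S1 + S2 - e)"
  have S2_Q: "S2 - Q = (1 / 2) *\<^sub>R (S1 + S2 - e)"
    by (simp add: Q_def)
  have "orthogonally_additive A"
    using T'(1) by (simp add: A_def orthogonally_additive_def scaleR_add_right)
  moreover have "0 \<le> P" "0 \<le> Q"
    unfolding P_def Q_def using b(2,3) by (simp_all add: le_double_imp_half_le)
  moreover have "P + Q = (1 / 2) *\<^sub>R (S1 + S2)"
  proof -
    have "P + Q = (S1 + S2) - (1 / 2) *\<^sub>R (S1 + S2)"
      by (simp add: P_def Q_def scaleR_diff_right)
    also have "\<dots> = (1 - 1 / 2) *\<^sub>R (S1 + S2)"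
      by (simp only: scaleR_diff_left scaleR_one)
    finally show ?thesis
      by simp
  qed
  moreover have "nW (A v) \<le> app (S1 - P) (nV v)" for v
    using scaleR_left_mono[OF T'(2)[of v], of "1 / 2"]
    by (simp add: A_def P_def W.norm_scale app_scale)
  moreover have "nW ((1 / 2) *\<^sub>R T v - A v) \<le> app (S2 - Q) (nV v)" for v
    using scaleR_left_mono[OF T'(3)[of v], of "1 / 2"] W.norm_scale[of "1 / 2" "T v - T' v"]
    unfolding S2_Q app_scale A_def scaleR_diff_right[of _ "T v" "T' v"] by simp
  ultimately show ?thesis
    by blast
qed

text \<open>After \<open>n\<close> steps \<open>B\<close> collects the distributed part, \<open>P\<close> and \<open>Q\<close> are the unused parts of \<open>S1\<close> and \<open>S2\<close>,
  and \<open>(1 / 2) ^ n\<close> times \<open>T\<close> is still to be distributed. Later increments of \<open>B\<close> are bounded by the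
  decrease of \<open>P\<close>, hence by \<open>(1 / 2) ^ n\<close> times \<open>S1 + S2\<close>, so the sequence of operators has a pointwise
  limit.\<close>
lemma split_dominated:
  assumes T: "orthogonally_additive T"
    and S: "0 \<le> S1" "0 \<le> S2"
    and bound: "\<And>v. nW (T v) \<le> app (S1 + S2) (nV v)"
  shows "\<exists>A. orthogonally_additive A \<and> (\<forall>v. nW (A v) \<le> app S1 (nV v)) \<and>
    (\<forall>v. nW (T v - A v) \<le> app S2 (nV v))"
proof -
  define good where "good n = (\<lambda>(B, P, Q). orthogonally_additive B \<and> 0 \<le> P \<and> 0 \<le> Q \<and>
    P + Q = (1 / 2) ^ n *\<^sub>R (S1 + S2) \<and> (\<forall>v. nW (B v) \<le> app (S1 - P) (nV v)) \<and>
    (\<forall>v. nW ((1 - (1 / 2) ^ n) *\<^sub>R T v - B v) \<le> app (S2 - Q) (nV v)))" for n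
  define step where "step x y \<longleftrightarrow>
      (\<forall>v. nW (fst y v - fst x v) \<le> app (fst (snd x) - fst (snd y)) (nV v))"
    for x y :: "('v \<Rightarrow> 'w) \<times> ('e, 'f) uryson_op \<times> ('e, 'f) uryson_op"
  have next_step: "\<exists>y. good (Suc n) y \<and> step x y" if gx: "good n x" for n x
  proof -
    obtain B P Q where x: "x = (B, P, Q)"
      by (cases x) auto
    have g: "orthogonally_additive B" "0 \<le> P" "0 \<le> Q" "P + Q = (1 / 2) ^ n *\<^sub>R (S1 + S2)"
      "\<And>v. nW (B v) \<le> app (S1 - P) (nV v)"
      "\<And>v. nW ((1 - (1 / 2) ^ n) *\<^sub>R T v - B v) \<le> app (S2 - Q) (nV v)"
      using gx by (auto simp: good_def x)
    have "nW ((1 / 2) ^ n *\<^sub>R T v) \<le> app (P + Q) (nV v)" for v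
      using scaleR_left_mono[OF bound[of v], of "(1 / 2) ^ n"]
      by (simp add: g(4) W.norm_scale app_scale)
    moreover have "orthogonally_additive (\<lambda>v. (1 / 2) ^ n *\<^sub>R T v)"
      using T by (simp add: orthogonally_additive_def scaleR_add_right)
    ultimately obtain A P' Q' where A: "orthogonally_additive A" "0 \<le> P'" "0 \<le> Q'"
      "P' + Q' = (1 / 2) *\<^sub>R (P + Q)" "\<And>v. nW (A v) \<le> app (P - P') (nV v)"
      "\<And>v. nW ((1 / 2) *\<^sub>R (1 / 2) ^ n *\<^sub>R T v - A v) \<le> app (Q - Q') (nV v)"
      using split_half[of "\<lambda>v. (1 / 2) ^ n *\<^sub>R T v" P Q] g(2,3) by blast
    define B' where "B' = (\<lambda>v. B v + A v)"
    have "nW (B' v) \<le> app (S1 - P') (nV v)" for v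
      using order_trans[OF W.norm_triangle add_mono[OF g(5) A(5)], of v v]
      by (simp add: B'_def minus_uryson_op.rep_eq)
    moreover have "nW ((1 - (1 / 2) ^ Suc n) *\<^sub>R T v - B' v) \<le> app (S2 - Q') (nV v)" for v
    proof -
      have "(1 - (1 / 2) ^ Suc n) *\<^sub>R T v - B' v =
          ((1 - (1 / 2) ^ n) *\<^sub>R T v - B v) + ((1 / 2) *\<^sub>R (1 / 2) ^ n *\<^sub>R T v - A v)"
      proof -
        have "(1 - (1 / 2) ^ Suc n :: real) = (1 - (1 / 2) ^ n) + (1 / 2) * (1 / 2) ^ n"
          by simp
        then show ?thesis
          by (simp only: B'_def scaleR_add_left scaleR_scaleR) simp
      qed
      then have "nW ((1 - (1 / 2) ^ Suc n) *\<^sub>R T v - B' v) \<le>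
          app (S2 - Q) (nV v) + app (Q - Q') (nV v)"
        using order_trans[OF W.norm_triangle add_mono[OF g(6) A(6)], of v v] by metis
      then show ?thesis
        by (simp add: minus_uryson_op.rep_eq)
    qed
    moreover have "orthogonally_additive B'"
      using orthogonally_additive_combine[OF g(1) A(1), of 1 1] by (simp add: B'_def)
    moreover have "P' + Q' = (1 / 2) ^ Suc n *\<^sub>R (S1 + S2)"
      using A(4) g(4) by simp
    ultimately have "good (Suc n) (B', P', Q')"
      using A(2,3) by (simp add: good_def)
    moreover have "step x (B', P', Q')"
      using A(5) by (simp add: step_def x B'_def)
    ultimately show ?thesis
      by blast
  qed
  have "good 0 (\<lambda>v. 0, S1, S2)"
    using S by (simp add: good_def orthogonally_additive_def W.norm_zero zero_uryson_op.rep_eq)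
  then obtain X where X: "\<And>n. good n (X n)" "\<And>n. step (X n) (X (Suc n))"
    using dependent_nat_choice[of good "\<lambda>_. step"] next_step by metis
  define B P Q where "B n = fst (X n)" and "P n = fst (snd (X n))" and "Q n = snd (snd (X n))" for n
  have g: "orthogonally_additive (B n)" "0 \<le> P n" "0 \<le> Q n"
    "P n + Q n = (1 / 2) ^ n *\<^sub>R (S1 + S2)" "nW (B n v) \<le> app (S1 - P n) (nV v)"
    "nW ((1 - (1 / 2) ^ n) *\<^sub>R T v - B n v) \<le> app (S2 - Q n) (nV v)" for n v
    using X(1)[of n] by (auto simp: good_def B_def P_def Q_def case_prod_unfold)
  have st: "nW (B (Suc n) v - B n v) \<le> app (P n - P (Suc n)) (nV v)" for n v
    using X(2)[of n] by (auto simp: step_def B_def P_def case_prod_unfold)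
  define s where "s v = app (S1 + S2) (nV v)" for v
  have s: "0 \<le> s v" for v
    using S by (simp add: s_def app_nonneg)
  have small: "app (P n) (nV v) \<le> (1 / 2) ^ n *\<^sub>R s v" for n v
  proof -
    have "P n \<le> (1 / 2) ^ n *\<^sub>R (S1 + S2)"
      using g(3)[of n] by (simp flip: g(4))
    from app_mono[OF this] show ?thesis
      by (simp add: s_def app_scale)
  qed
  have increment: "nW (B (n + k) v - B n v) \<le> app (P n - P (n + k)) (nV v)" for n k v
  proof (induction k)
    case 0
    show ?case
      by (simp add: W.norm_zero zero_uryson_op.rep_eq)
  next
    case (Suc k)
    have "nW (B (n + Suc k) v - B n v) \<le>
        app (P (n + k) - P (n + Suc k)) (nV v) + app (P n - P (n + k)) (nV v)"
      using order_trans[OF W.norm_dist_triangle add_mono[OF st[of "n + k" v] Suc]] by simp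
    then show ?case
      by (simp add: minus_uryson_op.rep_eq)
  qed
  have close: "nW (B m v - B n v) \<le> (1 / 2) ^ n *\<^sub>R s v" if "n \<le> m" for m n v
  proof -
    have "nW (B m v - B n v) \<le> app (P n - P m) (nV v)"
      using increment[of n "m - n" v] that by simp
    also have "\<dots> \<le> app (P n) (nV v)"
      by (rule app_mono) (simp add: g(2))
    finally show ?thesis
      using small order_trans by blast
  qed
  have null: "y \<le> 0" if "\<And>n. y \<le> (1 / 2) ^ n *\<^sub>R s v" for y v
    using W.le_geometric_imp_le_zero[OF s] that by blast
  have null_double: "y \<le> 0" if "\<And>n. y \<le> (1 / 2) ^ n *\<^sub>R s v + (1 / 2) ^ n *\<^sub>R s v" for y v
    by (rule le_zero_of_le_double[of UNIV "\<lambda>n. (1 / 2) ^ n *\<^sub>R s v"]) (use null that in blast)+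
  have "\<exists>x. \<forall>n\<in>UNIV. nW (x - B n v) \<le> (1 / 2) ^ n *\<^sub>R s v" for v
  proof (rule W.centre_exists)
    fix m n :: nat
    have nn: "0 \<le> (1 / 2 :: real) ^ k *\<^sub>R s v" for k
      by (simp add: s scaleR_nonneg_nonneg)
    show "nW (B m v - B n v) \<le> (1 / 2) ^ m *\<^sub>R s v + (1 / 2) ^ n *\<^sub>R s v"
      using close[of m n v] close[of n m v] nn
      by (cases "m \<le> n")
        (auto simp: W.norm_diff_commute[of "B m v"] intro: add_increasing add_increasing2)
  qed (use null in auto)
  then obtain A where A: "\<And>n v. nW (A v - B n v) \<le> (1 / 2) ^ n *\<^sub>R s v"
    by (metis UNIV_I)
  have "orthogonally_additive A"
    unfolding orthogonally_additive_def
  proof (intro allI impI)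
    fix x y assume xy: "inf (nV x) (nV y) = 0"
    have "nW (A (x + y) - (A x + A y)) \<le> (1 / 2) ^ n *\<^sub>R s (x + y) + (1 / 2) ^ n *\<^sub>R s (x + y)" for n
    proof -
      have "A (x + y) - (A x + A y) = (A (x + y) - B n (x + y)) - ((A x - B n x) + (A y - B n y))"
        using orthogonally_additiveD[OF g(1) xy] by simp
      then have "nW (A (x + y) - (A x + A y)) \<le>
          nW (A (x + y) - B n (x + y)) + nW ((A x - B n x) + (A y - B n y))"
        by (simp only: W.norm_triangle_diff)
      also have "\<dots> \<le> (1 / 2) ^ n *\<^sub>R s (x + y) + (nW (A x - B n x) + nW (A y - B n y))"
        by (intro add_mono A W.norm_triangle)
      also have "\<dots> \<le> (1 / 2) ^ n *\<^sub>R s (x + y) + ((1 / 2) ^ n *\<^sub>R s x + (1 / 2) ^ n *\<^sub>R s y)"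
        by (intro add_left_mono add_mono A)
      finally show ?thesis
        using app_norm_add[OF xy, of "S1 + S2"] by (simp add: s_def scaleR_add_right)
    qed
    then have "nW (A (x + y) - (A x + A y)) \<le> 0"
      by (rule null_double)
    then show "A (x + y) = A x + A y"
      using W.norm_le_zero by fastforce
  qed
  moreover have "nW (A v) \<le> app S1 (nV v)" for v
  proof -
    have "nW (A v) - app S1 (nV v) \<le> (1 / 2) ^ n *\<^sub>R s v" for n
    proof -
      have "nW (A v) \<le> nW (A v - B n v) + nW (B n v)"
        using W.norm_triangle[of "A v - B n v" "B n v"] by simp
      also have "\<dots> \<le> (1 / 2) ^ n *\<^sub>R s v + app (S1 - P n) (nV v)"
        by (intro add_mono A g)
      also have "\<dots> \<le> (1 / 2) ^ n *\<^sub>R s v + app S1 (nV v)"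
        by (intro add_left_mono app_mono) (simp add: g(2))
      finally show ?thesis
        by (simp add: algebra_simps)
    qed
    then show ?thesis
      using null[of "nW (A v) - app S1 (nV v)" v] by simp
  qed
  moreover have "nW (T v - A v) \<le> app S2 (nV v)" for v
  proof -
    have "nW (T v - A v) - app S2 (nV v) \<le> (1 / 2) ^ n *\<^sub>R s v + (1 / 2) ^ n *\<^sub>R s v" for n
    proof -
      have "T v - A v = (1 / 2) ^ n *\<^sub>R T v + (((1 - (1 / 2) ^ n) *\<^sub>R T v - B n v) - (A v - B n v))"
        by (simp add: scaleR_diff_left)
      then have "nW (T v - A v) \<le> nW ((1 / 2) ^ n *\<^sub>R T v) +
          nW (((1 - (1 / 2) ^ n) *\<^sub>R T v - B n v) - (A v - B n v))"
        by (simp only: W.norm_triangle)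
      also have "\<dots> \<le> (1 / 2) ^ n *\<^sub>R s v +
          (nW ((1 - (1 / 2) ^ n) *\<^sub>R T v - B n v) + nW (A v - B n v))"
        using bound[of v] by (intro add_mono W.norm_triangle_diff)
          (auto simp: W.norm_scale s_def intro: scaleR_left_mono)
      also have "\<dots> \<le> (1 / 2) ^ n *\<^sub>R s v + (app (S2 - Q n) (nV v) + (1 / 2) ^ n *\<^sub>R s v)"
        by (intro add_left_mono add_mono A g)
      also have "\<dots> \<le> (1 / 2) ^ n *\<^sub>R s v + (app S2 (nV v) + (1 / 2) ^ n *\<^sub>R s v)"
        by (intro add_left_mono add_right_mono app_mono) (simp add: g(3))
      finally show ?thesis
        by (simp add: algebra_simps)
    qed
    then have "nW (T v - A v) - app S2 (nV v) \<le> 0"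
      by (rule null_double)
    then show ?thesis
      by simp
  qed
  ultimately show ?thesis
    by blast
qed

section \<open>The space of dominated Uryson operators\<close>

lemma dominant_iff:
  "dominant nV nW T S \<longleftrightarrow> S \<in> uryson_even \<and> 0 \<le> S \<and> (\<forall>v. nW (T v) \<le> S (nV v))"
  by (simp add: dominant_def le_fun_def)

lemma dominant_add:
  assumes "dominant nV nW T S" "dominant nV nW T' S'"
  shows "dominant nV nW (T + T') (S + S')"
  using assms unfolding dominant_iff
  by (auto intro: subspace_add[OF subspace_uryson_even] add_nonneg_nonneg
      order_trans[OF W.norm_triangle] add_mono)

lemma dominant_scale:
  assumes "dominant nV nW T S"
  shows "dominant nV nW (c *\<^sub>R T) (\<bar>c\<bar> *\<^sub>R S)"
  unfolding dominant_iff
proof (intro conjI allI)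
  show "\<bar>c\<bar> *\<^sub>R S \<in> uryson_even" "0 \<le> \<bar>c\<bar> *\<^sub>R S"
    using assms
    by (simp_all add: dominant_iff subspace_scale[OF subspace_uryson_even] scaleR_nonneg_nonneg)
  show "nW ((c *\<^sub>R T) v) \<le> (\<bar>c\<bar> *\<^sub>R S) (nV v)" for v
    using assms by (simp add: dominant_iff scaleR_fun_def W.norm_scale scaleR_left_mono)
qed

lemma subspace_dominated: "subspace (dominated_uryson nV nW)"
proof (rule subspaceI)
  have "dominant nV nW 0 0"
    using subspace_0[OF subspace_uryson_even] by (auto simp: dominant_iff W.norm_zero)
  then show "0 \<in> dominated_uryson nV nW"
    by (auto simp: dominated_iff orthogonally_additive_def)
  show "T + T' \<in> dominated_uryson nV nW"
    if "T \<in> dominated_uryson nV nW" "T' \<in> dominated_uryson nV nW" for T T'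
  proof -
    have "orthogonally_additive (T + T')"
      using that orthogonally_additive_combine[of T T' 1 1]
      by (simp add: dominated_iff plus_fun_def)
    then show ?thesis
      using that dominant_add unfolding dominated_iff by blast
  qed
  show "c *\<^sub>R T \<in> dominated_uryson nV nW" if "T \<in> dominated_uryson nV nW" for c T
  proof -
    have "orthogonally_additive (c *\<^sub>R T)"
      using that orthogonally_additive_combine[of T T c 0]
      by (simp add: dominated_iff scaleR_fun_def)
    then show ?thesis
      using that dominant_scale unfolding dominated_iff by blast
  qed
qed

lemma archimedean_uryson_even:
  "archimedean_vector_lattice (uryson_even :: ('e \<Rightarrow> 'f) set)"
  unfolding archimedean_vector_lattice_def
proof (intro conjI ballI impI subspace_uryson_even)
  fix S T :: "'e \<Rightarrow> 'f"
  assume "S \<in> uryson_even" "T \<in> uryson_even"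
  then obtain X Y where XY: "S = app X" "T = app Y"
    using app_surj[of S] app_surj[of T] by blast
  have le: "app Z \<le> app Z' \<longleftrightarrow> Z \<le> Z'" for Z Z' :: "('e, 'f) uryson_op"
    by (simp add: less_eq_uryson_op.rep_eq)
  have "isLub uryson_even {S, T} (app (sup X Y))" "isGlb uryson_even {S, T} (app (inf X Y))"
    unfolding isLub_iff isGlb_iff XY by (auto simp: app le dest!: app_surj)
  then show "\<exists>s. isLub uryson_even {S, T} s" "\<exists>i. isGlb uryson_even {S, T} i"
    by blast+
next
  fix S T :: "'e \<Rightarrow> 'f"
  assume "\<forall>n. real n *\<^sub>R S \<le> T"
  then have "real n *\<^sub>R S x \<le> T x" for n x
    by (simp add: le_fun_def scaleR_fun_def)
  then have "S x \<le> 0" for x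
    by (rule W.archimedean)
  then show "S \<le> 0"
    by (simp add: le_fun_def)
qed

abbreviation "E \<equiv> exact_dominant nV nW"
abbreviation "D \<equiv> dominated_uryson nV nW"

lemma exact_dominant_nonneg: "T \<in> D \<Longrightarrow> 0 \<le> E T"
  using exact_dominant(1) by (simp add: dominant_iff)

text \<open>Applied to \<open>inverse c\<close> as well, this gives homogeneity.\<close>
lemma exact_dominant_scale_le:
  "T \<in> D \<Longrightarrow> E (c *\<^sub>R T) \<le> \<bar>c\<bar> *\<^sub>R E T"
  by (intro exact_dominant(2) dominant_scale exact_dominant(1)
      subspace_scale[OF subspace_dominated])

lemma lattice_normed_dominated: "lattice_normed_space D uryson_even E"
  unfolding lattice_normed_space_def
proof (intro conjI ballI allI subspace_dominated archimedean_uryson_even)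
  fix T assume T: "T \<in> D"
  note dom = exact_dominant(1)[OF T, unfolded dominant_iff]
  show "E T \<in> uryson_even" "0 \<le> E T"
    using dom by auto
  show "E T = 0 \<longleftrightarrow> T = 0"
  proof
    assume "E T = 0"
    then have "nW (T v) \<le> 0" for v
      using dom by simp
    then show "T = 0"
      using W.norm_le_zero by (simp add: fun_eq_iff)
  next
    assume "T = 0"
    then have "dominant nV nW T 0"
      using subspace_0[OF subspace_uryson_even] by (auto simp: dominant_iff W.norm_zero)
    then show "E T = 0"
      using exact_dominant(2)[OF T] dom order.antisym by blast
  qed
  show "E (T + T') \<le> E T + E T'" if "T' \<in> D" for T'
    using T that by (intro exact_dominant(2) dominant_add exact_dominant(1)
        subspace_add[OF subspace_dominated])
  show "E (c *\<^sub>R T) = \<bar>c\<bar> *\<^sub>R E T" for c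
  proof (cases "c = 0")
    case True
    have "E (0 *\<^sub>R T) \<le> 0"
      using exact_dominant_scale_le[OF T, of 0] by simp
    moreover have "0 \<le> E (0 *\<^sub>R T)"
      by (intro exact_dominant_nonneg subspace_scale[OF subspace_dominated T])
    ultimately have "E (0 *\<^sub>R T) = 0"
      by (rule order.antisym)
    with True show ?thesis
      by simp
  next
    case False
    have "E (inverse c *\<^sub>R c *\<^sub>R T) \<le> \<bar>inverse c\<bar> *\<^sub>R E (c *\<^sub>R T)"
      by (intro exact_dominant_scale_le subspace_scale[OF subspace_dominated T])
    then have "\<bar>c\<bar> *\<^sub>R E T \<le> \<bar>c\<bar> *\<^sub>R \<bar>inverse c\<bar> *\<^sub>R E (c *\<^sub>R T)"
      using False by (intro scaleR_left_mono) simp_all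
    also have "\<dots> = E (c *\<^sub>R T)"
      using False by (simp flip: abs_mult)
    finally show ?thesis
      using exact_dominant_scale_le[OF T, of c] by (intro order.antisym)
  qed
qed

text \<open>The two parts provided by \<open>split_dominated\<close> have exact dominants below \<open>S1\<close> and \<open>S2\<close>, and these sum
  to at least \<open>S1 + S2\<close> by the triangle inequality.\<close>
lemma decomposable_dominated: "decomposable D uryson_even E"
  unfolding decomposable_def
proof (intro ballI impI, elim conjE)
  fix T S1 S2
  assume T: "T \<in> D" and S: "S1 \<in> uryson_even" "S2 \<in> uryson_even" "0 \<le> S1" "0 \<le> S2"
    and eq: "E T = S1 + S2"
  obtain X Y where XY: "S1 = app X" "S2 = app Y"
    using app_surj[OF S(1)] app_surj[OF S(2)] by blast
  have orth: "orthogonally_additive T"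
    using T by (simp add: dominated_iff)
  have "nW (T v) \<le> app (X + Y) (nV v)" for v
    using exact_dominant(1)[OF T] eq unfolding dominant_iff XY by (simp add: plus_uryson_op.rep_eq)
  then obtain A where A: "orthogonally_additive A" "\<And>v. nW (A v) \<le> S1 (nV v)"
    "\<And>v. nW (T v - A v) \<le> S2 (nV v)"
    using split_dominated[OF orth, of X Y] S(3,4)
    unfolding XY by (auto simp: less_eq_uryson_op.rep_eq zero_uryson_op.rep_eq)
  define B where "B = T - A"
  have dom: "dominant nV nW A S1" "dominant nV nW B S2"
    using A S by (simp_all add: dominant_iff B_def)
  moreover have "orthogonally_additive B"
    using orthogonally_additive_combine[OF orth A(1), of 1 "- 1"] by (simp add: B_def fun_diff_def)
  ultimately have AB: "A \<in> D" "B \<in> D"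
    using A(1) by (auto simp: dominated_iff)
  have le: "E A \<le> S1" "E B \<le> S2"
    using AB dom by (auto intro: exact_dominant(2))
  have "T = A + B"
    by (simp add: B_def)
  then have sum: "S1 + S2 \<le> E A + E B"
    using lattice_normed_dominated AB unfolding lattice_normed_space_def eq[symmetric] by blast
  have "S1 + S2 \<le> E A + S2" "S1 + S2 \<le> S1 + E B"
    using order_trans[OF sum add_left_mono[OF le(2)]] order_trans[OF sum add_right_mono[OF le(1)]]
    by simp_all
  then have "S1 \<le> E A" "S2 \<le> E B"
    by simp_all
  with le have "E A = S1" "E B = S2"
    by (auto intro: order.antisym)
  with AB \<open>T = A + B\<close> show "\<exists>T1\<in>D. \<exists>T2\<in>D. T = T1 + T2 \<and> E T1 = S1 \<and> E T2 = S2"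
    by blast
qed

text \<open>The limit at \<open>v\<close> is the common centre of the values \<open>x b v\<close>, taken over all pairs of a \<open>\<gamma>\<close> and an
  index \<open>b\<close> beyond the point where the net varies by at most \<open>e \<gamma>\<close>. Listing all such \<open>b\<close> makes \<open>e\<close> itself,
  without a factor, a regulator for the limit.\<close>
lemma complete_dominated: "bo_complete TYPE('i) D uryson_even E"
  unfolding bo_complete_def
proof (intro allI impI, elim conjE)
  fix r :: "'i rel" and x
  assume r: "directed r" and xD: "x ` Field r \<subseteq> D" and fund: "bo_fundamental uryson_even E r x"
  have D: "x a \<in> D" if "a \<in> Field r" for a
    using xD that by blast
  obtain q :: "('e \<Rightarrow> 'f) rel" and e where
    q: "regulates uryson_even E (prod_rel r r) (\<lambda>(a, b). x a - x b) 0 q e"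
    using fund unfolding bo_fundamental_def bo_converges_def by blast
  have dq: "directed q" and e_dec: "\<And>i j. (i, j) \<in> q \<Longrightarrow> e j \<le> e i"
    and e_sub: "e ` Field q \<subseteq> uryson_even" and glb: "isGlb uryson_even (e ` Field q) 0"
    using q by (auto simp: regulates_def)
  have e_nonneg: "0 \<le> e \<gamma>" if "\<gamma> \<in> Field q" for \<gamma>
    using glb that by (simp add: isGlb_iff)
  have e_null: "y \<le> 0" if "\<And>\<gamma>. \<gamma> \<in> Field q \<Longrightarrow> y \<le> e \<gamma> z" for y z
    using uryson_even_isGlb_pointwise[OF dq e_dec e_sub glb that] .
  have e_null_double: "y \<le> 0" if "\<And>\<gamma>. \<gamma> \<in> Field q \<Longrightarrow> y \<le> e \<gamma> z + e \<gamma> z" for y z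
    by (rule le_zero_of_le_double[of "Field q" "\<lambda>\<gamma>. e \<gamma> z"]) (use e_null that in blast)+
  \<comment> \<open>The pair of indices that bounds the double net is replaced by a common upper bound of the two.\<close>
  have "\<exists>a\<in>Field r. \<forall>b c. (a, b) \<in> r \<longrightarrow> (a, c) \<in> r \<longrightarrow> E (x b - x c) \<le> e \<gamma>" if \<gamma>: "\<gamma> \<in> Field q" for \<gamma>
  proof -
    obtain p where p: "p \<in> Field (prod_rel r r)"
      "\<And>p'. (p, p') \<in> prod_rel r r \<Longrightarrow> E (0 - (case p' of (a, b) \<Rightarrow> x a - x b)) \<le> e \<gamma>"
      using q \<gamma> unfolding regulates_def by blast
    obtain a1 a2 where a12: "p = (a1, a2)"
      by (cases p)
    with p(1) have "a1 \<in> Field r" "a2 \<in> Field r"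
      by (auto simp: Field_def prod_rel_def)
    then obtain a where a: "(a1, a) \<in> r" "(a2, a) \<in> r"
      using directedD(4)[OF r] by blast
    have "E (x b - x c) \<le> e \<gamma>" if "(a, b) \<in> r" "(a, c) \<in> r" for b c
    proof -
      have "((a1, a2), (c, b)) \<in> prod_rel r r"
        using a that directedD(3)[OF r] by (auto simp: prod_rel_def)
      then show ?thesis
        using p(2)[of "(c, b)"] a12 by simp
    qed
    moreover have "a \<in> Field r"
      using a by (auto simp: Field_def)
    ultimately show ?thesis
      by blast
  qed
  then obtain \<alpha> where \<alpha>: "\<And>\<gamma>. \<gamma> \<in> Field q \<Longrightarrow> \<alpha> \<gamma> \<in> Field r"
    "\<And>\<gamma> b c. \<gamma> \<in> Field q \<Longrightarrow> (\<alpha> \<gamma>, b) \<in> r \<Longrightarrow> (\<alpha> \<gamma>, c) \<in> r \<Longrightarrow> E (x b - x c) \<le> e \<gamma>"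
    by metis
  have close: "nW (x b v - x c v) \<le> e \<gamma> (nV v)"
    if "\<gamma> \<in> Field q" "(\<alpha> \<gamma>, b) \<in> r" "(\<alpha> \<gamma>, c) \<in> r" for \<gamma> b c v
  proof -
    have "b \<in> Field r" "c \<in> Field r"
      using that by (auto simp: Field_def)
    then have "x b - x c \<in> D"
      using D by (intro subspace_diff[OF subspace_dominated])
    then have "nW ((x b - x c) v) \<le> E (x b - x c) (nV v)"
      using exact_dominant(1) unfolding dominant_iff by blast
    also have "\<dots> \<le> e \<gamma> (nV v)"
      using \<alpha>(2)[OF that] by (simp add: le_fun_def)
    finally show ?thesis
      by simp
  qed
  define I where "I = {(\<gamma>, b). \<gamma> \<in> Field q \<and> (\<alpha> \<gamma>, b) \<in> r}"
  have tail: "(\<gamma>, \<alpha> \<gamma>) \<in> I" if "\<gamma> \<in> Field q" for \<gamma>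
    using that \<alpha>(1) directedD(2)[OF r] by (simp add: I_def)
  have "\<exists>w. \<forall>i\<in>I. nW (w - x (snd i) v) \<le> e (fst i) (nV v)" for v
  proof (rule W.centre_exists)
    show "I \<noteq> {}"
      using directedD(1)[OF dq] tail by blast
    show "y \<le> 0" if "\<And>i. i \<in> I \<Longrightarrow> y \<le> e (fst i) (nV v)" for y
      using that[OF tail] by (intro e_null[of y "nV v"]) simp
    fix i j assume "i \<in> I" "j \<in> I"
    then obtain \<gamma> b \<delta> c where ij: "i = (\<gamma>, b)" "j = (\<delta>, c)" "\<gamma> \<in> Field q" "\<delta> \<in> Field q"
      "(\<alpha> \<gamma>, b) \<in> r" "(\<alpha> \<delta>, c) \<in> r"
      by (auto simp: I_def)
    then obtain d where d: "(b, d) \<in> r" "(c, d) \<in> r"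
      using directedD(4)[OF r, of b c] by (auto simp: Field_def)
    then have "(\<alpha> \<gamma>, d) \<in> r" "(\<alpha> \<delta>, d) \<in> r"
      using ij directedD(3)[OF r] by blast+
    then have "nW (x b v - x d v) \<le> e \<gamma> (nV v)" "nW (x d v - x c v) \<le> e \<delta> (nV v)"
      using ij close by blast+
    then show "nW (x (snd i) v - x (snd j) v) \<le> e (fst i) (nV v) + e (fst j) (nV v)"
      using order_trans[OF W.norm_dist_triangle add_mono] ij by simp
  qed
  then obtain T where T: "\<And>v \<gamma> b. \<gamma> \<in> Field q \<Longrightarrow> (\<alpha> \<gamma>, b) \<in> r \<Longrightarrow> nW (T v - x b v) \<le> e \<gamma> (nV v)"
    unfolding I_def by (metis (no_types, lifting) case_prodI fst_conv mem_Collect_eq snd_conv)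
  have orth: "orthogonally_additive T"
    unfolding orthogonally_additive_def
  proof (intro allI impI)
    fix u v assume uv: "inf (nV u) (nV v) = 0"
    have "nW (T (u + v) - (T u + T v)) \<le> e \<gamma> (nV (u + v)) + e \<gamma> (nV (u + v))" if \<gamma>: "\<gamma> \<in> Field q" for \<gamma>
    proof -
      define b where "b = \<alpha> \<gamma>"
      have b: "b \<in> Field r" "(\<alpha> \<gamma>, b) \<in> r"
        using \<gamma> \<alpha>(1) directedD(2)[OF r] by (simp_all add: b_def)
      have "orthogonally_additive (x b)"
        using D[OF b(1)] by (simp add: dominated_iff)
      then have "T (u + v) - (T u + T v) = (T (u + v) - x b (u + v)) - ((T u - x b u) + (T v - x b v))"
        by (simp add: orthogonally_additiveD[OF _ uv])
      then have "nW (T (u + v) - (T u + T v)) \<le>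
          nW (T (u + v) - x b (u + v)) + nW ((T u - x b u) + (T v - x b v))"
        by (simp only: W.norm_triangle_diff)
      also have "\<dots> \<le> e \<gamma> (nV (u + v)) + (nW (T u - x b u) + nW (T v - x b v))"
        by (intro add_mono T \<gamma> b W.norm_triangle)
      also have "\<dots> \<le> e \<gamma> (nV (u + v)) + (e \<gamma> (nV u) + e \<gamma> (nV v))"
        by (intro add_left_mono add_mono T \<gamma> b)
      also have "e \<gamma> (nV u) + e \<gamma> (nV v) = e \<gamma> (nV (u + v))"
        using e_sub \<gamma> uryson_even_add_pos[OF _ uv, of "e \<gamma>"]
        by (simp add: V.norm_add_disjoint[OF uv] image_subset_iff)
      finally show ?thesis .
    qed
    then have "nW (T (u + v) - (T u + T v)) \<le> 0"
      by (rule e_null_double)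
    then show "T (u + v) = T u + T v"
      using W.norm_le_zero by fastforce
  qed
  have dom: "dominant nV nW (T - x b) (e \<gamma>)" if "\<gamma> \<in> Field q" "(\<alpha> \<gamma>, b) \<in> r" for \<gamma> b
    using that T e_sub e_nonneg by (auto simp: dominant_iff)
  have diff: "T - x b \<in> D" if "\<gamma> \<in> Field q" "(\<alpha> \<gamma>, b) \<in> r" for \<gamma> b
  proof -
    have "orthogonally_additive (x b)"
      using D[of b] that by (auto simp: dominated_iff Field_def)
    then have "orthogonally_additive (T - x b)"
      using orthogonally_additive_combine[OF orth, of "x b" 1 "- 1"] by (simp add: fun_diff_def)
    then show ?thesis
      using dom[OF that] by (auto simp: dominated_iff)
  qed
  obtain \<gamma> where \<gamma>: "\<gamma> \<in> Field q"
    using directedD(1)[OF dq] by blast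
  have "T = (T - x (\<alpha> \<gamma>)) + x (\<alpha> \<gamma>)"
    by simp
  moreover have "T - x (\<alpha> \<gamma>) \<in> D" "x (\<alpha> \<gamma>) \<in> D"
    using \<gamma> diff tail D \<alpha>(1) by (auto simp: I_def)
  ultimately have "T \<in> D"
    using subspace_add[OF subspace_dominated] by metis
  moreover have "regulates uryson_even E r x T q e"
    unfolding regulates_def
  proof (intro conjI ballI dq e_sub glb)
    show "case p of (\<gamma>, \<delta>) \<Rightarrow> e \<delta> \<le> e \<gamma>" if "p \<in> q" for p
      using that e_dec by auto
    show "\<exists>a\<in>Field r. \<forall>b. (a, b) \<in> r \<longrightarrow> E (T - x b) \<le> e \<gamma>" if "\<gamma> \<in> Field q" for \<gamma>
      using that \<alpha>(1) exact_dominant(2)[OF diff dom] by blast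
  qed
  ultimately show "\<exists>T\<in>D. bo_converges uryson_even E r x T"
    using bo_convergesI by blast
qed

end

theorem theorem5p1:
  fixes nV :: "'v::real_vector \<Rightarrow> 'e::{ordered_real_vector, lattice_ab_group_add_abs}"
    and nW :: "'w::real_vector \<Rightarrow> 'f::{ordered_real_vector, conditionally_complete_lattice}"
  assumes "lattice_normed_space UNIV UNIV nV"
    and "decomposable UNIV UNIV nV"
    and "banach_kantorovich TYPE('w \<times> 'w set) UNIV UNIV nW"
  shows "banach_kantorovich TYPE('i)
    (dominated_uryson nV nW)
    (uryson_even :: ('e \<Rightarrow> 'f) set)
    (exact_dominant nV nW)"
proof -
  interpret bk_pair nV nW
    using assms unfolding banach_kantorovich_def by unfold_locales simp_all
  show ?thesis
    unfolding banach_kantorovich_def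
    by (intro conjI lattice_normed_dominated decomposable_dominated complete_dominated)
qed

end
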